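(* Let $g:\mathbb{D}\to\mathbb{D}$ be a hyperbolic holomorphic self-map with Denjoy--Wolff point $\tau\in\partial\mathbb{D}$ and angular multiplier $\alpha\in(0,1)$. Let $h:\mathbb{D}\to\mathbb{H}$ be a Koenigs function of $g$, normalized by $h\circ g=\alpha^{-1}h$. Then the following are equivalent: (i) $g$ has an extremal hyperbolic rate; (ii) $h$ is conformal at $\tau$, in the sense that for some (equivalently, every) conformal map $\phi_\tau$ of $\mathbb{D}$ onto $\mathbb{H}$ satisfying $\phi_\tau(\tau)=\infty$, the angular limit $$\angle\lim_{z\to\tau}\frac{h(z)}{\phi_\tau(z)}$$ exists and belongs to $\mathbb{C}\setminus\{0\}$.
   Context: $\mathbb{D}=\{z\in\mathbb{C}:|z|<1\}$, $\mathbb{H}=\{z\in\mathbb{C}:\operatorname{Im}z>0\}$. $g^{\circ n}$ denotes the $n$-th iterate of $g$. The hyperbolic distance on $\mathbb{D}$ is $\rho_{\mathbb{D}}(z,w)=2\tanh^{-1}\left|\frac{z-w}{1-\bar w z}\right|$. The Stolz region at $\tau\in\partial\mathbb{D}$ with parameter $M>1$ is $S(\tau,M)=\{z\in\mathbb{D}:|z-\tau|<M(1-|z|)\}$. A limit as $z\to\tau$ is angular (non-tangential), written $\angle\lim_{z\to\tau}$, if it holds as $z\to\tau$ within $S(\tau,M)$ for every $M>1$. A holomorphic $g:\mathbb{D}\to\mathbb{D}$ with no fixed point in $\mathbb{D}$ has a unique Denjoy--Wolff point $\tau\in\partial\mathbb{D}$, with $g^{\circ n}(z)\to\tau$ for every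 $z\in\mathbb{D}$. The angular limit $\alpha:=\angle\lim_{z\to\tau}g'(z)$ exists, equals $\liminf_{z\to\tau}\frac{1-|g(z)|}{1-|z|}$, and lies in $(0,1]$; it is the angular multiplier. The map $g$ is hyperbolic if $\alpha\in(0,1)$. A Koenigs function of $g$ here is a nonzero holomorphic function $h$ satisfying $h(g(z))=\alpha^{-1}h(z)$ and $|h(z)|\to\infty$ as $z\to\tau$ non-tangentially. A hyperbolic $g$ has an extremal hyperbolic rate if for some (equivalently, every) $z,w\in\mathbb{D}$ the quantity $\rho_{\mathbb{D}}(g^{\circ n}(z),w)-n\log\frac1\alpha$ is bounded as $n\to\infty$ (the bound may depend on $z,w,g$). *)

theory Defs
  imports "HOL-Complex_Analysis.Complex_Analysis"
begin

abbreviation unit_disc :: "complex set" where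
  "unit_disc \<equiv> ball 0 1"

definition upper_halfplane :: "complex set" where
  "upper_halfplane = {z. Im z > 0}"

definition hyp_dist :: "complex \<Rightarrow> complex \<Rightarrow> real" where
  "hyp_dist z w = 2 * artanh (cmod ((z - w) / (1 - cnj w * z)))"

definition stolz :: "complex \<Rightarrow> real \<Rightarrow> complex set" where
  "stolz \<tau> M = {z \<in> unit_disc. cmod (z - \<tau>) < M * (1 - cmod z)}"

text \<open>Taking \<open>F = nhds L\<close> gives the finite angular limit \<open>L\<close>, and \<open>F = at_infinity\<close>
  gives non-tangential divergence of the modulus.\<close>

definition angular_lim :: "(complex \<Rightarrow> complex) \<Rightarrow> complex filter \<Rightarrow> complex \<Rightarrow> bool" where
  "angular_lim f F \<tau> \<longleftrightarrow> (\<forall>M>1. filterlim f F (at \<tau> within stolz \<tau> M))"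

definition denjoy_wolff_point :: "(complex \<Rightarrow> complex) \<Rightarrow> complex \<Rightarrow> bool" where
  "denjoy_wolff_point g \<tau> \<longleftrightarrow>
     \<tau> \<in> sphere 0 1 \<and> (\<forall>z\<in>unit_disc. (\<lambda>n. (g ^^ n) z) \<longlonglongrightarrow> \<tau>)"

definition angular_multiplier :: "(complex \<Rightarrow> complex) \<Rightarrow> complex \<Rightarrow> real \<Rightarrow> bool" where
  "angular_multiplier g \<tau> \<alpha> \<longleftrightarrow> angular_lim (deriv g) (nhds (of_real \<alpha>)) \<tau>"

definition hyperbolic_self_map :: "(complex \<Rightarrow> complex) \<Rightarrow> complex \<Rightarrow> real \<Rightarrow> bool" where
  "hyperbolic_self_map g \<tau> \<alpha> \<longleftrightarrow>
     g holomorphic_on unit_disc \<and> g \<in> unit_disc \<rightarrow> unit_disc \<and>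
     (\<forall>z\<in>unit_disc. g z \<noteq> z) \<and>
     denjoy_wolff_point g \<tau> \<and> angular_multiplier g \<tau> \<alpha> \<and> 0 < \<alpha> \<and> \<alpha> < 1"

definition koenigs_function ::
  "(complex \<Rightarrow> complex) \<Rightarrow> complex \<Rightarrow> real \<Rightarrow> (complex \<Rightarrow> complex) \<Rightarrow> bool" where
  "koenigs_function g \<tau> \<alpha> h \<longleftrightarrow>
     h holomorphic_on unit_disc \<and> (\<exists>z\<in>unit_disc. h z \<noteq> 0) \<and>
     (\<forall>z\<in>unit_disc. h (g z) = inverse (of_real \<alpha>) * h z) \<and>
     angular_lim h at_infinity \<tau>"

definition extremal_rate_at ::
  "(complex \<Rightarrow> complex) \<Rightarrow> real \<Rightarrow> complex \<Rightarrow> complex \<Rightarrow> bool" where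
  "extremal_rate_at g \<alpha> z w \<longleftrightarrow>
     Bseq (\<lambda>n. hyp_dist ((g ^^ n) z) w - real n * ln (1 / \<alpha>))"

definition extremal_hyperbolic_rate :: "(complex \<Rightarrow> complex) \<Rightarrow> real \<Rightarrow> bool" where
  "extremal_hyperbolic_rate g \<alpha> \<longleftrightarrow>
     (\<exists>z\<in>unit_disc. \<exists>w\<in>unit_disc. extremal_rate_at g \<alpha> z w)"

text \<open>Conformal maps of the disc onto the upper half-plane are Moebius transformations, so
  \<open>\<phi>(\<tau>) = \<infinity>\<close> for the extension to the closed disc is the same as the unrestricted limit
  \<open>\<phi>(z) \<rightarrow> \<infinity>\<close> as \<open>z \<rightarrow> \<tau>\<close> within the disc.\<close>

definition conformal_onto_halfplane :: "complex \<Rightarrow> (complex \<Rightarrow> complex) \<Rightarrow> bool" where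
  "conformal_onto_halfplane \<tau> \<phi> \<longleftrightarrow>
     \<phi> holomorphic_on unit_disc \<and> bij_betw \<phi> unit_disc upper_halfplane \<and>
     filterlim \<phi> at_infinity (at \<tau> within unit_disc)"

definition conformal_relative_to ::
  "(complex \<Rightarrow> complex) \<Rightarrow> complex \<Rightarrow> (complex \<Rightarrow> complex) \<Rightarrow> bool" where
  "conformal_relative_to h \<tau> \<phi> \<longleftrightarrow>
     (\<exists>L. L \<noteq> 0 \<and> angular_lim (\<lambda>z. h z / \<phi> z) (nhds L) \<tau>)"

definition conformal_at_boundary :: "(complex \<Rightarrow> complex) \<Rightarrow> complex \<Rightarrow> bool" where
  "conformal_at_boundary h \<tau> \<longleftrightarrow>
     (\<exists>\<phi>. conformal_onto_halfplane \<tau> \<phi> \<and> conformal_relative_to h \<tau> \<phi>)"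

end

theory Submission imports Defs begin

text \<open>Transport everything to the upper half-plane by the Cayley map \<open>cayley \<tau>\<close>, which sends \<open>\<tau>\<close> to
  infinity; heights there measure horocycles at \<open>\<tau>\<close>, sectors correspond to Stolz regions, and
  hyperbolic distances are controlled by heights and Euclidean distances.

  The Koenigs function \<open>h\<close>, being a map into the half-plane, always has an angular derivative: by
  the Julia--Caratheodory theorem (\<open>julia_caratheodory\<close>) the ratio \<open>h z / cayley \<tau> z\<close> has the angular
  limit \<open>c\<close>, the infimum of the ratio of heights. A general conformal map onto the half-plane
  with pole at \<open>\<tau>\<close> differs from the Cayley map by an asymptotic positive factor
  (\<open>conformal_ratio_limit\<close>), so conformality of \<open>h\<close> at \<open>\<tau>\<close>, for some or for every
  comparison map, means \<open>c \<noteq> 0\<close>.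

  On the dynamical side, let \<open>u n\<close> be an orbit of \<open>g\<close> in the half-plane. Julia's lemma gives
  \<open>Im (u n) \<ge> \<alpha>\<^sup>-\<^sup>n * Im (u 0)\<close> (\<open>Im_cayley_iterate\<close>), and the distance of \<open>u n\<close> to a fixed point is,
  up to a bounded error, minus the logarithm of the boundary distance of the orbit in the disc. Therefore
  the rate is extremal exactly if \<open>|u n|\<close> is also bounded by a multiple of \<open>\<alpha>\<^sup>-\<^sup>n\<close>.

  If it is, the orbit is non-tangential; since \<open>|h|\<close> grows like \<open>\<alpha>\<^sup>-\<^sup>n\<close> along it, the angular limit
  \<open>c\<close>, evaluated on the orbit, is nonzero (\<open>angular_limit_nonzero_of_extremal\<close>). Conversely, \<open>c > 0\<close>
  means that \<open>Im h\<close> dominates the height, so \<open>Im (u n)\<close> is at most a multiple of \<open>\<alpha>\<^sup>-\<^sup>n\<close>; because the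
  hyperbolic steps of an orbit are bounded, the horizontal displacement is a geometric sum of the same
  order, and the rate is extremal for all points (\<open>extremal_of_Im_bound\<close>).\<close>

section \<open>The Schwarz--Pick and Julia inequalities on the disc\<close>

lemma cmod_one_minus_cnj_mult:
  "(cmod (1 - cnj w * z))\<^sup>2 = (cmod (z - w))\<^sup>2 + (1 - (cmod z)\<^sup>2) * (1 - (cmod w)\<^sup>2)"
  unfolding cmod_power2 by (simp add: algebra_simps power2_eq_square)

lemma one_minus_cmod_sq_pos: "z \<in> unit_disc \<Longrightarrow> 0 < 1 - (cmod z)\<^sup>2"
  by (simp add: power_less_one_iff abs_square_less_1)

lemma one_minus_cnj_mult_bounds:
  assumes "z \<in> unit_disc" "w \<in> unit_disc"
  shows "1 - cmod w \<le> cmod (1 - cnj w * z)" "cmod (1 - cnj w * z) \<le> 2"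
proof -
  have "cmod (cnj w * z) \<le> cmod w * 1"
    unfolding norm_mult using assms by (intro mult_mono) auto
  with assms show "1 - cmod w \<le> cmod (1 - cnj w * z)" "cmod (1 - cnj w * z) \<le> 2"
    using norm_triangle_ineq2[of 1 "cnj w * z"] norm_triangle_ineq4[of 1 "cnj w * z"] by auto
qed

text \<open>This is the contraction of the pseudo-hyperbolic distance, with denominators cleared and the
  factor \<open>|1 - cnj w * z|\<^sup>2\<close> eliminated by \<open>cmod_one_minus_cnj_mult\<close>. In this form both sides involve only
  \<open>|z - w|\<close> and \<open>1 - |z|\<^sup>2\<close>, which transform simply under the half-plane coordinate. It comes
  from the Schwarz lemma after moving \<open>w\<close> and \<open>g w\<close> to the origin.\<close>

lemma schwarz_pick_disc:
  assumes hol: "g holomorphic_on unit_disc" and self: "g \<in> unit_disc \<rightarrow> unit_disc"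
    and z: "z \<in> unit_disc" and w: "w \<in> unit_disc"
  shows "(cmod (g z - g w))\<^sup>2 * ((1 - (cmod z)\<^sup>2) * (1 - (cmod w)\<^sup>2))
       \<le> (cmod (z - w))\<^sup>2 * ((1 - (cmod (g z))\<^sup>2) * (1 - (cmod (g w))\<^sup>2))"
proof -
  let ?M = "Moebius_function 0"
  have gz: "g z \<in> unit_disc" and gw: "g w \<in> unit_disc" using self z w by auto
  define f where "f = ?M (g w) \<circ> g \<circ> ?M (- w)"
  have m1: "?M (- w) holomorphic_on unit_disc" "?M (g w) holomorphic_on unit_disc"
    using Moebius_function_holomorphic w gw by auto
  have m2: "?M (- w) \<in> unit_disc \<rightarrow> unit_disc" "?M (g w) \<in> unit_disc \<rightarrow> unit_disc"
    using Moebius_function_norm_lt_1 w gw by auto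
  have holf: "f holomorphic_on unit_disc"
    unfolding f_def
    by (intro holomorphic_on_compose holomorphic_on_subset[OF hol] holomorphic_on_subset[OF m1(2)] m1(1))
       (use m2 self in auto)
  have f0: "f 0 = 0"
    by (simp add: f_def Moebius_function_of_zero Moebius_function_eq_zero)
  have fb: "cmod (f \<zeta>) < 1" if "cmod \<zeta> < 1" for \<zeta>
    using that m2 self by (auto simp: f_def Pi_iff)
  define \<zeta> where "\<zeta> = ?M w z"
  have z_eq: "?M (- w) \<zeta> = z"
    unfolding \<zeta>_def using Moebius_function_compose[of "- w" w z] w z by auto
  have \<zeta>: "cmod \<zeta> < 1" using Moebius_function_norm_lt_1 w z by (auto simp: \<zeta>_def)
  have le: "cmod (?M (g w) (g z)) \<le> cmod (?M w z)"
    using Schwarz_Lemma(1)[OF holf f0 fb \<zeta>] by (simp add: f_def z_eq) (simp add: \<zeta>_def)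
  define A B P Q where "A = (cmod (g z - g w))\<^sup>2" and "B = (cmod (z - w))\<^sup>2"
    and "P = (1 - (cmod (g z))\<^sup>2) * (1 - (cmod (g w))\<^sup>2)"
    and "Q = (1 - (cmod z)\<^sup>2) * (1 - (cmod w)\<^sup>2)"
  have nn: "A \<ge> 0" "B \<ge> 0" "P > 0" "Q > 0"
    using z w gz gw unfolding A_def B_def P_def Q_def
    by (auto intro!: mult_pos_pos one_minus_cmod_sq_pos)
  have "(cmod (?M (g w) (g z)))\<^sup>2 \<le> (cmod (?M w z))\<^sup>2" using le by (intro power_mono) auto
  then have "A / (A + P) \<le> B / (B + Q)"
    by (simp add: Moebius_function_simple norm_divide power_divide cmod_one_minus_cnj_mult
        A_def B_def P_def Q_def)
  then have "A * Q \<le> B * P"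
    using nn by (simp add: divide_simps add_nonneg_pos less_imp_neq split: if_splits) (simp add: algebra_simps)
  then show ?thesis by (simp add: A_def B_def P_def Q_def)
qed

text \<open>Let one of the two points in Schwarz--Pick run to \<open>\<tau>\<close> along a sequence on which \<open>g\<close> multiplies the
  distance to the circle by at most \<open>\<beta>\<close>. Those vanishing distances cancel, and what
  remains in the limit is Julia's inequality between horocycles at \<open>\<tau>\<close>. With \<open>\<beta> = 1\<close> it gives
  Wolff's theorem; with \<open>\<beta>\<close> close to \<open>\<alpha>\<close> it will give the growth of an orbit towards \<open>\<tau>\<close>.\<close>

lemma julia_horocycle:
  assumes hol: "g holomorphic_on unit_disc" and self: "g \<in> unit_disc \<rightarrow> unit_disc"
    and \<tau>: "cmod \<tau> = 1"
    and s: "\<And>n. s n \<in> unit_disc" "s \<longlonglongrightarrow> \<tau>" and gs: "(\<lambda>n. g (s n)) \<longlonglongrightarrow> \<tau>"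
    and dil: "\<forall>\<^sub>F n in sequentially. 1 - cmod (g (s n)) \<le> \<beta> * (1 - cmod (s n))"
    and z: "z \<in> unit_disc"
  shows "(1 - (cmod z)\<^sup>2) * (cmod (\<tau> - g z))\<^sup>2 \<le> \<beta> * (1 - (cmod (g z))\<^sup>2) * (cmod (\<tau> - z))\<^sup>2"
proof -
  have gz: "g z \<in> unit_disc" using self z by auto
  define a b where "a = 1 - (cmod z)\<^sup>2" and "b = 1 - (cmod (g z))\<^sup>2"
  have ab: "a > 0" "b > 0" using z gz one_minus_cmod_sq_pos unfolding a_def b_def by auto
  have "a * (1 + cmod (s n)) * (cmod (1 - cnj (g (s n)) * g z))\<^sup>2
      \<le> \<beta> * b * (1 + cmod (g (s n))) * (cmod (1 - cnj (s n) * z))\<^sup>2"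
    if d: "1 - cmod (g (s n)) \<le> \<beta> * (1 - cmod (s n))" for n
  proof -
    let ?w = "s n" and ?v = "g (s n)"
    have w: "?w \<in> unit_disc" by (rule s)
    have v: "?v \<in> unit_disc" using self w by auto
    define X Y where "X = (cmod (1 - cnj ?v * g z))\<^sup>2" and "Y = (cmod (1 - cnj ?w * z))\<^sup>2"
    have XY: "X \<ge> 0" "Y \<ge> 0" by (auto simp: X_def Y_def)
    \<comment> \<open>Adding the product of all four factors \<open>1 - |.|\<^sup>2\<close> to both sides of Schwarz--Pick brings back
      the squared moduli \<open>X\<close> and \<open>Y\<close>.\<close>
    have "a * (1 - (cmod ?w)\<^sup>2) * X \<le> b * (1 - (cmod ?v)\<^sup>2) * Y"
      using schwarz_pick_disc[OF hol self z w]
      unfolding X_def Y_def cmod_one_minus_cnj_mult a_def b_def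
      by (simp add: algebra_simps)
    then have "(1 - cmod ?w) * (a * (1 + cmod ?w) * X) \<le> (1 - cmod ?v) * (b * (1 + cmod ?v) * Y)"
      by (simp add: power2_eq_square algebra_simps)
    also have "\<dots> \<le> (\<beta> * (1 - cmod ?w)) * (b * (1 + cmod ?v) * Y)"
      using d ab XY by (intro mult_right_mono mult_nonneg_nonneg) auto
    finally have "(1 - cmod ?w) * (a * (1 + cmod ?w) * X) \<le> (1 - cmod ?w) * (\<beta> * b * (1 + cmod ?v) * Y)"
      by (simp add: mult_ac)
    moreover have "1 - cmod ?w > 0" using w by simp
    ultimately show ?thesis
      unfolding X_def Y_def by (simp only: mult_le_cancel_left_pos)
  qed
  then have ev: "\<forall>\<^sub>F n in sequentially. a * (1 + cmod (s n)) * (cmod (1 - cnj (g (s n)) * g z))\<^sup>2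
      \<le> \<beta> * b * (1 + cmod (g (s n))) * (cmod (1 - cnj (s n) * z))\<^sup>2"
    using dil by (auto elim: eventually_mono)
  have "a * (1 + cmod \<tau>) * (cmod (1 - cnj \<tau> * g z))\<^sup>2 \<le> \<beta> * b * (1 + cmod \<tau>) * (cmod (1 - cnj \<tau> * z))\<^sup>2"
    by (rule tendsto_le[OF _ _ _ ev]) (auto intro!: tendsto_intros s gs)
  moreover have "cmod (1 - cnj \<tau> * u) = cmod (\<tau> - u)" for u
  proof -
    have "1 - cnj \<tau> * u = cnj \<tau> * (\<tau> - u)"
      using \<tau> complex_norm_square[of \<tau>] by (simp add: algebra_simps)
    then show ?thesis using \<tau> by (simp add: norm_mult)
  qed
  ultimately have "2 * (a * (cmod (\<tau> - g z))\<^sup>2) \<le> 2 * (\<beta> * b * (cmod (\<tau> - z))\<^sup>2)"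
    using \<tau> by (simp add: mult_ac)
  then show ?thesis unfolding a_def b_def by linarith
qed

section \<open>The half-plane coordinate at a boundary point\<close>

definition cayley :: "complex \<Rightarrow> complex \<Rightarrow> complex" where
  "cayley \<tau> z = \<i> * (\<tau> + z) / (\<tau> - z)"

lemma cmod_le_cmod_plus_i:
  assumes "Im w > 0"
  shows "cmod w \<le> cmod (w + \<i>)" "Im w + 1 \<le> cmod (w + \<i>)"
proof -
  have "(cmod w)\<^sup>2 \<le> (cmod (w + \<i>))\<^sup>2"
    unfolding cmod_power2 using assms by (simp add: power2_eq_square algebra_simps)
  then show "cmod w \<le> cmod (w + \<i>)" by (rule power2_le_imp_le) auto
  show "Im w + 1 \<le> cmod (w + \<i>)" using abs_Im_le_cmod[of "w + \<i>"] by simp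
qed

locale boundary_point =
  fixes \<tau> :: complex
  assumes norm_\<tau>: "cmod \<tau> = 1"
begin

lemma \<tau>_neq: "z \<in> unit_disc \<Longrightarrow> \<tau> \<noteq> z"
  using norm_\<tau> by auto

text \<open>The height of the half-plane coordinate is the Poisson kernel at \<open>\<tau>\<close>, so its level sets are the
  horocycles at \<open>\<tau>\<close>.\<close>

lemma Im_cayley:
  assumes "z \<in> unit_disc"
  shows "Im (cayley \<tau> z) = (1 - (cmod z)\<^sup>2) / (cmod (\<tau> - z))\<^sup>2"
proof -
  have "Im (cayley \<tau> z) = Re ((\<tau> + z) * cnj (\<tau> - z)) / (cmod (\<tau> - z))\<^sup>2"
    unfolding cayley_def by (simp add: complex_div_cnj[of _ "\<tau> - z"] mult.assoc Im_divide_of_real flip: of_real_power)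
  moreover have "Re ((\<tau> + z) * cnj (\<tau> - z)) = (cmod \<tau>)\<^sup>2 - (cmod z)\<^sup>2"
    unfolding cmod_power2 by (simp add: algebra_simps power2_eq_square)
  ultimately show ?thesis by (simp add: norm_\<tau>)
qed

lemma Im_cayley_pos: "z \<in> unit_disc \<Longrightarrow> 0 < Im (cayley \<tau> z)"
  using one_minus_cmod_sq_pos \<tau>_neq by (simp add: Im_cayley)

lemma cmod_cayley_plus_i:
  assumes "z \<in> unit_disc"
  shows "cmod (cayley \<tau> z + \<i>) = 2 / cmod (\<tau> - z)"
proof -
  have "cayley \<tau> z + \<i> = 2 * \<i> * \<tau> / (\<tau> - z)"
    using \<tau>_neq[OF assms] by (simp add: cayley_def field_simps)
  then show ?thesis by (simp add: norm_divide norm_mult norm_\<tau>)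
qed

lemma cmod_cayley_diff:
  assumes "z \<in> unit_disc" "w \<in> unit_disc"
  shows "(cmod (cayley \<tau> z - cayley \<tau> w))\<^sup>2 = 4 * (cmod (z - w))\<^sup>2 / ((cmod (\<tau> - z))\<^sup>2 * (cmod (\<tau> - w))\<^sup>2)"
proof -
  have "cayley \<tau> z - cayley \<tau> w = 2 * \<i> * \<tau> * (z - w) / ((\<tau> - z) * (\<tau> - w))"
    using \<tau>_neq[OF assms(1)] \<tau>_neq[OF assms(2)] by (simp add: cayley_def field_simps)
  then show ?thesis by (simp add: norm_divide norm_mult norm_\<tau> power_divide power_mult_distrib)
qed

lemma holomorphic_cayley: "cayley \<tau> holomorphic_on unit_disc"
  unfolding cayley_def using \<tau>_neq by (auto intro!: holomorphic_intros)

text \<open>This turns the boundary distance, on which the hyperbolic rate depends, into height and modulus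
  in the half-plane.\<close>

lemma one_minus_cmod_sq_cayley:
  assumes "z \<in> unit_disc"
  shows "1 - (cmod z)\<^sup>2 = 4 * Im (cayley \<tau> z) / (cmod (cayley \<tau> z + \<i>))\<^sup>2"
  using \<tau>_neq[OF assms] by (simp add: Im_cayley[OF assms] cmod_cayley_plus_i[OF assms] power_divide)

definition cayley_inv :: "complex \<Rightarrow> complex" where
  "cayley_inv w = \<tau> * (w - \<i>) / (w + \<i>)"

lemma plus_i_nonzero: "w \<in> upper_halfplane \<Longrightarrow> w + \<i> \<noteq> 0"
  by (auto simp: upper_halfplane_def complex_eq_iff)

lemma cayley_inv:
  assumes "w \<in> upper_halfplane"
  shows "cayley_inv w \<in> unit_disc" "cayley \<tau> (cayley_inv w) = w"
proof -
  have "Im w > 0" using assms by (simp add: upper_halfplane_def)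
  then have "(cmod (w - \<i>))\<^sup>2 < (cmod (w + \<i>))\<^sup>2"
    unfolding cmod_power2 by (simp add: power2_eq_square algebra_simps)
  then have "cmod (w - \<i>) < cmod (w + \<i>)" using power_less_imp_less_base by fastforce
  then show "cayley_inv w \<in> unit_disc"
    using plus_i_nonzero[OF assms] by (simp add: cayley_inv_def norm_mult norm_divide norm_\<tau>)
  have nz: "w + \<i> \<noteq> 0" "\<tau> \<noteq> 0" using plus_i_nonzero[OF assms] norm_\<tau> by auto
  have "\<tau> + cayley_inv w = 2 * \<tau> * w / (w + \<i>)" "\<tau> - cayley_inv w = 2 * \<tau> * \<i> / (w + \<i>)"
    using nz by (auto simp: cayley_inv_def field_simps)
  then show "cayley \<tau> (cayley_inv w) = w"
    using nz by (simp add: cayley_def)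
qed

lemma cayley_inv_cayley:
  assumes "z \<in> unit_disc"
  shows "cayley_inv (cayley \<tau> z) = z"
proof -
  have nz: "\<tau> \<noteq> z" "\<tau> \<noteq> 0" using \<tau>_neq[OF assms] norm_\<tau> by auto
  have "cayley \<tau> z + \<i> = 2 * \<i> * \<tau> / (\<tau> - z)" "cayley \<tau> z - \<i> = 2 * \<i> * z / (\<tau> - z)"
    using nz by (auto simp: cayley_def field_simps)
  then show ?thesis using nz by (simp add: cayley_inv_def)
qed

lemma holomorphic_cayley_inv: "cayley_inv holomorphic_on upper_halfplane"
  unfolding cayley_inv_def using plus_i_nonzero by (auto intro!: holomorphic_intros)

lemma cayley_in: "cayley \<tau> \<in> unit_disc \<rightarrow> upper_halfplane"
  using Im_cayley_pos by (auto simp: upper_halfplane_def)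

text \<open>Schwarz--Pick for \<open>f\<close> as a self-map of the half-plane in the coordinate \<open>cayley \<tau>\<close>: the quantity
  \<open>|u - v|\<^sup>2 / (Im u * Im v)\<close> is a function of the hyperbolic distance. The inequality is
  multiplied out so that it can be used without dividing.\<close>

lemma schwarz_pick_halfplane:
  assumes hol: "f holomorphic_on unit_disc" and maps: "f \<in> unit_disc \<rightarrow> upper_halfplane"
    and z: "z \<in> unit_disc" and w: "w \<in> unit_disc"
  shows "(cmod (f z - f w))\<^sup>2 * (Im (cayley \<tau> z) * Im (cayley \<tau> w))
       \<le> (cmod (cayley \<tau> z - cayley \<tau> w))\<^sup>2 * (Im (f z) * Im (f w))"
proof -
  define g where "g = cayley_inv \<circ> f"
  have g: "g holomorphic_on unit_disc"
    unfolding g_def using maps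
    by (intro holomorphic_on_compose hol holomorphic_on_subset[OF holomorphic_cayley_inv]) auto
  have gm: "g \<in> unit_disc \<rightarrow> unit_disc"
    using maps cayley_inv(1) unfolding g_def Pi_iff comp_def by blast
  have fe: "f u = cayley \<tau> (g u)" if "u \<in> unit_disc" for u
    using cayley_inv(2)[OF funcset_mem[OF maps that]] by (simp add: g_def)
  have gz: "g z \<in> unit_disc" "g w \<in> unit_disc" using gm z w by auto
  define a b c d where "a = (cmod (\<tau> - z))\<^sup>2" and "b = (cmod (\<tau> - w))\<^sup>2"
    and "c = (cmod (\<tau> - g z))\<^sup>2" and "d = (cmod (\<tau> - g w))\<^sup>2"
  have pos: "a > 0" "b > 0" "c > 0" "d > 0"
    using \<tau>_neq z w gz unfolding a_def b_def c_def d_def by auto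
  have "4 * ((cmod (g z - g w))\<^sup>2 * ((1 - (cmod z)\<^sup>2) * (1 - (cmod w)\<^sup>2))) / (a * b * c * d)
      \<le> 4 * ((cmod (z - w))\<^sup>2 * ((1 - (cmod (g z))\<^sup>2) * (1 - (cmod (g w))\<^sup>2))) / (a * b * c * d)"
    using schwarz_pick_disc[OF g gm z w] pos by (intro divide_right_mono mult_left_mono) auto
  then show ?thesis
    using z w gz by (simp add: fe Im_cayley cmod_cayley_diff mult_ac flip: a_def b_def c_def d_def)
qed

end

section \<open>Stolz regions in the half-plane coordinate\<close>

context boundary_point
begin

lemma filterlim_cayley: "filterlim (cayley \<tau>) at_infinity (at \<tau> within unit_disc)"
  unfolding cayley_def
proof (rule filterlim_divide_at_infinity)
  show "((\<lambda>z. \<i> * (\<tau> + z)) \<longlongrightarrow> \<i> * (\<tau> + \<tau>)) (at \<tau> within unit_disc)"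
    by (intro tendsto_intros)
  have "((\<lambda>z. \<tau> - z) \<longlongrightarrow> \<tau> - \<tau>) (at \<tau> within unit_disc)"
    by (intro tendsto_intros)
  then show "filterlim (\<lambda>z. \<tau> - z) (at 0) (at \<tau> within unit_disc)"
    using \<tau>_neq by (auto simp: filterlim_at eventually_at_filter)
  show "\<i> * (\<tau> + \<tau>) \<noteq> 0" using norm_\<tau> by auto
qed

lemma stolz_filter_le: "at \<tau> within stolz \<tau> M \<le> at \<tau> within unit_disc"
  by (rule at_le) (auto simp: stolz_def)

lemma filterlim_cayley_stolz: "filterlim (cayley \<tau>) at_infinity (at \<tau> within stolz \<tau> M)"
  using filterlim_cayley stolz_filter_le by (rule filterlim_mono[OF _ order_refl])

lemma eventually_in_stolz: "\<forall>\<^sub>F z in at \<tau> within stolz \<tau> M. z \<in> stolz \<tau> M"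
  by (simp add: eventually_at_filter)

text \<open>Stolz regions at \<open>\<tau>\<close> are comparable with the sectors \<open>|u| \<le> K * Im u\<close> of the half-plane; this
  inclusion and the next one express it.\<close>

lemma cmod_cayley_le_Im_of_stolz:
  assumes "z \<in> stolz \<tau> M"
  shows "cmod (cayley \<tau> z) \<le> 2 * M * Im (cayley \<tau> z)"
proof -
  have z: "z \<in> unit_disc" and lt: "cmod (\<tau> - z) < M * (1 - cmod z)"
    using assms by (auto simp: stolz_def norm_minus_commute)
  have pos: "cmod (\<tau> - z) > 0" using \<tau>_neq[OF z] by simp
  then have "0 < M * (1 - cmod z)" using lt by linarith
  then have M: "0 < M" using z by (simp add: zero_less_mult_iff)
  have "1 - cmod z \<le> 1 - (cmod z)\<^sup>2"
    using z by (simp add: power2_eq_square mult_left_le)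
  then have le: "cmod (\<tau> - z) \<le> M * (1 - (cmod z)\<^sup>2)"
    using lt M by (meson less_imp_le mult_left_mono order_trans)
  have "cmod (cayley \<tau> z) \<le> 2 / cmod (\<tau> - z)"
    using cmod_le_cmod_plus_i(1)[OF Im_cayley_pos[OF z]] by (simp only: cmod_cayley_plus_i[OF z])
  also have "\<dots> = 2 * cmod (\<tau> - z) / (cmod (\<tau> - z))\<^sup>2"
    using pos by (simp add: power2_eq_square)
  also have "\<dots> \<le> 2 * (M * (1 - (cmod z)\<^sup>2)) / (cmod (\<tau> - z))\<^sup>2"
    using le by (intro divide_right_mono mult_left_mono) auto
  finally show ?thesis by (simp add: Im_cayley[OF z])
qed

lemma in_stolz_of_cayley:
  assumes z: "z \<in> unit_disc" and le: "cmod (cayley \<tau> z + \<i>) \<le> K * Im (cayley \<tau> z)" and "K < M"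
  shows "z \<in> stolz \<tau> M"
proof -
  have pos: "cmod (\<tau> - z) > 0" using \<tau>_neq[OF z] by simp
  have "2 * cmod (\<tau> - z) \<le> K * (1 - (cmod z)\<^sup>2)"
    using le pos unfolding cmod_cayley_plus_i[OF z] Im_cayley[OF z]
    by (simp add: divide_simps power2_eq_square)
  moreover have K: "K > 0"
  proof -
    have "0 < K * Im (cayley \<tau> z)"
      using le Im_cayley_pos[OF z] cmod_le_cmod_plus_i(2)[OF Im_cayley_pos[OF z]] by linarith
    then show ?thesis using Im_cayley_pos[OF z] by (simp add: zero_less_mult_iff)
  qed
  moreover have "1 - (cmod z)\<^sup>2 \<le> 2 * (1 - cmod z)"
    using sum_squares_bound[of 1 "cmod z"] by simp
  moreover have "K * (1 - (cmod z)\<^sup>2) \<le> K * (2 * (1 - cmod z))"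
    using calculation by (intro mult_left_mono) auto
  ultimately have "2 * cmod (\<tau> - z) \<le> 2 * (K * (1 - cmod z))" by linarith
  also have "\<dots> < 2 * (M * (1 - cmod z))"
    using z \<open>K < M\<close> by simp
  finally show ?thesis using z by (simp add: stolz_def norm_minus_commute)
qed

definition radial :: "nat \<Rightarrow> complex" where
  "radial n = (1 - 1 / of_nat (n + 2)) * \<tau>"

lemma radial_eq: "radial n = (1 - 1 / real (n + 2)) *\<^sub>R \<tau>"
  by (simp add: radial_def scaleR_conv_of_real)

lemma cmod_radial: "cmod (radial n) = 1 - 1 / real (n + 2)"
  unfolding radial_eq by (simp add: norm_\<tau>)

lemma radial_in_disc: "radial n \<in> unit_disc"
  by (simp add: cmod_radial)

lemma cmod_radial_diff: "cmod (radial n - \<tau>) = 1 - cmod (radial n)"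
proof -
  have "radial n - \<tau> = (- (1 / real (n + 2))) *\<^sub>R \<tau>"
    unfolding radial_eq by (simp add: algebra_simps)
  then have "cmod (radial n - \<tau>) = 1 / real (n + 2)" by (simp add: norm_\<tau>)
  then show ?thesis by (simp add: cmod_radial)
qed

lemma radial_in_stolz: "M > 1 \<Longrightarrow> radial n \<in> stolz \<tau> M"
  using radial_in_disc[of n] by (simp add: stolz_def cmod_radial_diff)

lemma radial_lim: "radial \<longlonglongrightarrow> \<tau>"
proof -
  have "(\<lambda>n. cmod (radial n - \<tau>)) \<longlonglongrightarrow> 0"
    unfolding cmod_radial_diff cmod_radial
    using LIMSEQ_ignore_initial_segment[OF lim_inverse_n', of 2] by simp
  then show ?thesis
    by (simp add: tendsto_norm_zero_iff LIM_zero_iff)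
qed

lemma filterlim_stolz_sequence:
  assumes "s \<longlonglongrightarrow> \<tau>" "\<And>n. s n \<in> stolz \<tau> M"
  shows "filterlim s (at \<tau> within stolz \<tau> M) sequentially"
proof -
  have "s n \<noteq> \<tau>" for n using assms(2)[of n] \<tau>_neq[of "s n"] by (auto simp: stolz_def)
  then show ?thesis using assms by (simp add: filterlim_at)
qed

lemma stolz_filter_nontrivial:
  assumes "M > 1" shows "at \<tau> within stolz \<tau> M \<noteq> bot"
proof
  assume "at \<tau> within stolz \<tau> M = bot"
  then have "filterlim radial bot sequentially"
    using filterlim_stolz_sequence[OF radial_lim radial_in_stolz[OF assms]] by simp
  then show False by (simp add: filterlim_def filtermap_bot_iff bot_unique)
qed

section \<open>The angular derivative at infinity\<close>

text \<open>The basic estimate of the angular derivative: \<open>Im (f z)\<close> on the right-hand side of Schwarz--Pick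
  is at most \<open>|f z|\<close>, so Schwarz--Pick becomes a quadratic inequality for \<open>|f z|\<close>. Hence one base point
  \<open>w\<close> at which \<open>f\<close> is low makes \<open>f\<close> small relative to the coordinate in every sector.\<close>

lemma schwarz_pick_growth:
  assumes hol: "f holomorphic_on unit_disc" and maps: "f \<in> unit_disc \<rightarrow> upper_halfplane"
    and z: "z \<in> unit_disc" and w: "w \<in> unit_disc"
    and small: "Im (f w) \<le> \<epsilon> * Im (cayley \<tau> w)" and "\<epsilon> \<ge> 0"
    and near: "(cmod (cayley \<tau> z - cayley \<tau> w))\<^sup>2 \<le> K * cmod (cayley \<tau> z) * Im (cayley \<tau> z)"
  shows "cmod (f z) \<le> 2 * cmod (f w) + \<epsilon> * K * cmod (cayley \<tau> z)"
proof (rule ccontr)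
  define x a y where "x = cmod (f z)" and "a = cmod (f w)" and "y = cmod (cayley \<tau> z)"
  define p q where "p = Im (cayley \<tau> z)" and "q = Im (cayley \<tau> w)"
  have pos: "p > 0" "q > 0" using Im_cayley_pos z w by (auto simp: p_def q_def)
  have "0 \<le> (cmod (cayley \<tau> z - cayley \<tau> w))\<^sup>2" by simp
  then have "0 \<le> K * y * p" using near unfolding y_def p_def by linarith
  then have Ky: "0 \<le> K * y" using pos by (simp add: zero_le_mult_iff)
  have fz: "0 < Im (f z)" "0 < Im (f w)" using maps z w by (auto simp: upper_halfplane_def)
  have fx: "Im (f z) \<le> x" unfolding x_def using abs_Im_le_cmod[of "f z"] by simp
  have "(x - a)\<^sup>2 \<le> (cmod (f z - f w))\<^sup>2"
    unfolding x_def a_def using norm_triangle_ineq3[of "f z" "f w"] by (simp add: abs_le_square_iff[symmetric])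
  then have "(x - a)\<^sup>2 * (p * q) \<le> (cmod (f z - f w))\<^sup>2 * (p * q)"
    using pos by (intro mult_right_mono) auto
  also have "\<dots> \<le> (cmod (cayley \<tau> z - cayley \<tau> w))\<^sup>2 * (Im (f z) * Im (f w))"
    unfolding p_def q_def by (rule schwarz_pick_halfplane[OF hol maps z w])
  also have "\<dots> \<le> (K * y * p) * (x * (\<epsilon> * q))"
    using near small fx fz Ky pos unfolding y_def p_def q_def
    by (intro mult_mono) auto
  finally have "(x - a)\<^sup>2 * (p * q) \<le> (\<epsilon> * K * y * x) * (p * q)" by (simp add: mult_ac)
  then have le: "(x - a)\<^sup>2 \<le> \<epsilon> * K * y * x" using pos by simp
  assume "\<not> ?thesis"
  then have gt: "x - 2 * a > \<epsilon> * K * y" by (simp add: x_def a_def y_def)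
  have "x > 0" using fx fz by linarith
  then have "\<epsilon> * K * y * x < (x - 2 * a) * x" using gt by simp
  also have "\<dots> \<le> (x - a)\<^sup>2" by (simp add: power2_eq_square algebra_simps)
  finally show False using le by simp
qed

text \<open>The angular derivative of \<open>f\<close> at infinity is the infimum \<open>c\<close> of the ratio of heights. Subtracting
  \<open>c\<close> times the coordinate leaves a map whose ratio of heights has infimum zero, and the previous
  estimate shows that such a map is \<open>o(|cayley \<tau> z|)\<close> in Stolz regions.\<close>

theorem julia_caratheodory:
  assumes hol: "f holomorphic_on unit_disc" and maps: "f \<in> unit_disc \<rightarrow> upper_halfplane"
  obtains c where "c \<ge> 0" "\<And>z. z \<in> unit_disc \<Longrightarrow> c * Im (cayley \<tau> z) \<le> Im (f z)"
    "\<And>b. (\<And>z. z \<in> unit_disc \<Longrightarrow> b * Im (cayley \<tau> z) \<le> Im (f z)) \<Longrightarrow> b \<le> c"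
    "angular_lim (\<lambda>z. f z / cayley \<tau> z) (nhds (of_real c)) \<tau>"
proof -
  define Q where "Q z = Im (f z) / Im (cayley \<tau> z)" for z
  have Qpos: "0 < Q z" if "z \<in> unit_disc" for z
    using that maps Im_cayley_pos by (auto simp: Q_def upper_halfplane_def Pi_iff intro!: divide_pos_pos)
  define c where "c = (INF z\<in>unit_disc. Q z)"
  have bdd: "bdd_below (Q ` unit_disc)" using Qpos by (intro bdd_belowI2[of _ 0]) (auto intro: less_imp_le)
  have ne: "unit_disc \<noteq> {}" by auto
  have c0: "c \<ge> 0" unfolding c_def using Qpos by (intro cINF_greatest) (auto intro: less_imp_le)
  have cle: "c * Im (cayley \<tau> z) \<le> Im (f z)" if "z \<in> unit_disc" for z
    using cINF_lower[OF bdd that] Im_cayley_pos[OF that] by (simp add: c_def Q_def divide_simps)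
  have greatest: "b \<le> c" if "\<And>z. z \<in> unit_disc \<Longrightarrow> b * Im (cayley \<tau> z) \<le> Im (f z)" for b
    unfolding c_def Q_def using that Im_cayley_pos by (intro cINF_greatest ne) (auto simp: divide_simps)
  have "((\<lambda>z. f z / cayley \<tau> z) \<longlongrightarrow> of_real c) (at \<tau> within stolz \<tau> M)" if "M > 1" for M
  proof (rule tendstoI)
    fix e :: real assume e: "e > 0"
    \<comment> \<open>Chosen so that the errors collected below, \<open>(16 * M + 2) * \<delta>\<close>, stay below \<open>e\<close>.\<close>
    define \<delta> where "\<delta> = e / (16 * M + 3)"
    have \<delta>: "\<delta> > 0" using e \<open>M > 1\<close> by (simp add: \<delta>_def)
    obtain w where w: "w \<in> unit_disc" and Qw: "Q w < c + \<delta>"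
      using cINF_less_iff[OF ne bdd, of "c + \<delta>"] \<delta> by (auto simp: c_def)
    \<comment> \<open>Subtracting \<open>c - \<delta>\<close> instead of \<open>c\<close> keeps \<open>F\<close> strictly inside the half-plane, even when \<open>f\<close>
      is \<open>c\<close> times the coordinate plus a real constant.\<close>
    define F where "F z = f z - of_real (c - \<delta>) * cayley \<tau> z" for z
    have holF: "F holomorphic_on unit_disc"
      unfolding F_def by (intro holomorphic_intros hol holomorphic_cayley)
    have ImF: "Im (F z) = (Im (f z) - c * Im (cayley \<tau> z)) + \<delta> * Im (cayley \<tau> z)" for z
      by (simp add: F_def algebra_simps)
    have mapsF: "F \<in> unit_disc \<rightarrow> upper_halfplane"
      using cle \<delta> Im_cayley_pos
      by (auto simp: upper_halfplane_def ImF intro!: add_nonneg_pos mult_pos_pos)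
    have small: "Im (F w) \<le> (2 * \<delta>) * Im (cayley \<tau> w)"
      using Qw Im_cayley_pos[OF w] by (simp add: ImF Q_def divide_simps algebra_simps)
    define R where "R = max (cmod (cayley \<tau> w)) (2 * cmod (F w) / \<delta>)"
    have "\<forall>\<^sub>F z in at \<tau> within stolz \<tau> M. R \<le> cmod (cayley \<tau> z)"
      using filterlim_at_infinity_imp_norm_at_top[OF filterlim_cayley_stolz[of M]]
      by (simp add: filterlim_at_top)
    with eventually_in_stolz
    show "\<forall>\<^sub>F z in at \<tau> within stolz \<tau> M. dist (f z / cayley \<tau> z) (of_real c) < e"
    proof eventually_elim
      case (elim z)
      have z: "z \<in> unit_disc" using elim by (simp add: stolz_def)
      define y where "y = cmod (cayley \<tau> z)"
      have nz: "cayley \<tau> z \<noteq> 0" using Im_cayley_pos[OF z] by auto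
      then have y: "y > 0" by (simp add: y_def)
      have "cmod (cayley \<tau> z - cayley \<tau> w) \<le> 2 * y"
        using elim norm_triangle_ineq4[of "cayley \<tau> z" "cayley \<tau> w"] by (auto simp: R_def y_def)
      then have "(cmod (cayley \<tau> z - cayley \<tau> w))\<^sup>2 \<le> (2 * y)\<^sup>2" by (intro power_mono) auto
      also have "\<dots> = 4 * y * y" by (simp add: power2_eq_square)
      also have "\<dots> \<le> 4 * y * (2 * M * Im (cayley \<tau> z))"
        using cmod_cayley_le_Im_of_stolz[OF elim(1)] y by (intro mult_left_mono) (auto simp: y_def)
      finally have near: "(cmod (cayley \<tau> z - cayley \<tau> w))\<^sup>2 \<le> (8 * M) * cmod (cayley \<tau> z) * Im (cayley \<tau> z)"
        by (simp add: y_def mult_ac)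
      \<comment> \<open>The constant term \<open>2 * |F w|\<close> is absorbed because the coordinate tends to infinity.\<close>
      have "cmod (F z) \<le> 2 * cmod (F w) + (2 * \<delta>) * (8 * M) * y"
        unfolding y_def using \<delta> by (intro schwarz_pick_growth[OF holF mapsF z w small _ near]) auto
      also have "2 * cmod (F w) \<le> \<delta> * y"
        using elim \<delta> by (auto simp: R_def y_def divide_simps mult_ac)
      finally have Fz: "cmod (F z) \<le> (16 * M + 1) * \<delta> * y" by (simp add: algebra_simps)
      have "f z / cayley \<tau> z - of_real c = (F z - of_real \<delta> * cayley \<tau> z) / cayley \<tau> z"
        using nz by (simp add: F_def field_simps)
      then have "dist (f z / cayley \<tau> z) (of_real c) = cmod (F z - of_real \<delta> * cayley \<tau> z) / y"
        by (simp add: dist_norm norm_divide y_def)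
      also have "\<dots> \<le> (cmod (F z) + \<delta> * y) / y"
        using y \<delta> norm_triangle_ineq4[of "F z" "of_real \<delta> * cayley \<tau> z"]
        by (intro divide_right_mono) (auto simp: norm_mult y_def)
      also have "\<dots> \<le> ((16 * M + 1) * \<delta> * y + \<delta> * y) / y"
        using Fz y by (intro divide_right_mono) auto
      also have "\<dots> = (16 * M + 2) * \<delta>" using y by (simp add: field_simps)
      also have "\<dots> < (16 * M + 3) * \<delta>" using \<delta> by simp
      also have "\<dots> = e" using \<open>M > 1\<close> by (simp add: \<delta>_def)
      finally show ?case .
    qed
  qed
  then show thesis using that[OF c0 cle greatest] by (auto simp: angular_lim_def)
qed

end

section \<open>Conformal maps onto the half-plane\<close>

lemma tendsto_ratio_translates:
  fixes f :: "'a \<Rightarrow> complex"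
  assumes "filterlim f at_infinity F"
  shows "((\<lambda>z. (f z - a) / (f z - b)) \<longlongrightarrow> 1) F"
proof -
  have inf: "filterlim (\<lambda>z. f z - b) at_infinity F"
    using tendsto_add_filterlim_at_infinity'[OF assms tendsto_const[of "- b"]] by simp
  then have "((\<lambda>z. 1 + (b - a) / (f z - b)) \<longlongrightarrow> 1 + 0) F"
    by (intro tendsto_add tendsto_const tendsto_divide_0[OF tendsto_const])
  moreover have "\<forall>\<^sub>F z in F. f z - b \<noteq> 0"
    using inf by (rule filterlim_at_infinity_imp_eventually_ne)
  then have "\<forall>\<^sub>F z in F. 1 + (b - a) / (f z - b) = (f z - a) / (f z - b)"
    by (rule eventually_mono) (simp add: field_simps)
  ultimately show ?thesis by (simp add: filterlim_cong)
qed

context boundary_point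
begin

lemma conformal_cayley: "conformal_onto_halfplane \<tau> (cayley \<tau>)"
proof -
  have "bij_betw (cayley \<tau>) unit_disc upper_halfplane"
    by (rule bij_betw_byWitness[where f' = cayley_inv])
       (use cayley_in cayley_inv cayley_inv_cayley in \<open>auto simp del: mem_ball\<close>)
  then show ?thesis
    using holomorphic_cayley filterlim_cayley by (simp add: conformal_onto_halfplane_def)
qed

text \<open>Schwarz--Pick for \<open>\<phi>\<close> and for its inverse: read in the coordinate \<open>cayley \<tau>\<close>, \<open>\<phi>\<close> is a hyperbolic
  isometry of the half-plane.\<close>

lemma conformal_isometry:
  assumes conf: "conformal_onto_halfplane \<tau> \<phi>" and z: "z \<in> unit_disc" and w: "w \<in> unit_disc"
  shows "(cmod (\<phi> z - \<phi> w))\<^sup>2 * (Im (cayley \<tau> z) * Im (cayley \<tau> w))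
       = (cmod (cayley \<tau> z - cayley \<tau> w))\<^sup>2 * (Im (\<phi> z) * Im (\<phi> w))"
proof (rule antisym)
  have hol: "\<phi> holomorphic_on unit_disc" and bij: "bij_betw \<phi> unit_disc upper_halfplane"
    using conf by (auto simp: conformal_onto_halfplane_def)
  have maps: "\<phi> \<in> unit_disc \<rightarrow> upper_halfplane" using bij by (auto simp: bij_betw_def)
  show "(cmod (\<phi> z - \<phi> w))\<^sup>2 * (Im (cayley \<tau> z) * Im (cayley \<tau> w))
       \<le> (cmod (cayley \<tau> z - cayley \<tau> w))\<^sup>2 * (Im (\<phi> z) * Im (\<phi> w))"
    by (rule schwarz_pick_halfplane[OF hol maps z w])
  obtain \<psi> where \<psi>: "\<psi> holomorphic_on (\<phi> ` unit_disc)" "\<And>z. z \<in> unit_disc \<Longrightarrow> \<psi> (\<phi> z) = z"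
    using holomorphic_has_inverse[OF hol open_ball bij_betw_imp_inj_on[OF bij]] by metis
  have im: "\<phi> ` unit_disc = upper_halfplane" using bij by (simp add: bij_betw_def)
  have \<psi>_maps: "\<psi> \<in> upper_halfplane \<rightarrow> unit_disc" unfolding im[symmetric] using \<psi>(2) by (auto simp del: mem_ball)
  define G where "G = cayley \<tau> \<circ> \<psi> \<circ> cayley \<tau>"
  have holG: "G holomorphic_on unit_disc"
    unfolding G_def using cayley_in \<psi>_maps
    by (intro holomorphic_on_compose holomorphic_cayley holomorphic_on_subset[OF holomorphic_cayley]
        holomorphic_on_subset[OF \<psi>(1)[unfolded im]]) (auto simp del: mem_ball)
  have mapsG: "G \<in> unit_disc \<rightarrow> upper_halfplane"
    using cayley_in \<psi>_maps unfolding G_def Pi_iff comp_def by blast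
  have phi: "\<phi> v \<in> upper_halfplane" if "v \<in> unit_disc" for v using maps that by auto
  have "G (cayley_inv (\<phi> v)) = cayley \<tau> v" if "v \<in> unit_disc" for v
    using cayley_inv(2)[OF phi[OF that]] \<psi>(2)[OF that] by (simp add: G_def)
  then show "(cmod (cayley \<tau> z - cayley \<tau> w))\<^sup>2 * (Im (\<phi> z) * Im (\<phi> w))
      \<le> (cmod (\<phi> z - \<phi> w))\<^sup>2 * (Im (cayley \<tau> z) * Im (cayley \<tau> w))"
    using schwarz_pick_halfplane[OF holG mapsG cayley_inv(1)[OF phi[OF z]] cayley_inv(1)[OF phi[OF w]]]
      cayley_inv(2)[OF phi[OF z]] cayley_inv(2)[OF phi[OF w]] z w by simp
qed

text \<open>Divide the isometry identity for the pair \<open>z, w\<close> by the one for \<open>z, 0\<close> and let \<open>z\<close> tend to \<open>\<tau>\<close>. Both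
  \<open>\<phi> z\<close> and \<open>cayley \<tau> z\<close> tend to infinity, so the quotients of squared distances tend to one
  and only the heights of \<open>w\<close> and \<open>0\<close> survive. In other words, \<open>\<phi>\<close> preserves horocycles at
  \<open>\<tau>\<close>.\<close>

lemma conformal_Im_proportional:
  assumes conf: "conformal_onto_halfplane \<tau> \<phi>" and w: "w \<in> unit_disc"
  shows "Im (\<phi> w) / Im (cayley \<tau> w) = Im (\<phi> 0) / Im (cayley \<tau> 0)"
proof -
  let ?F = "at \<tau> within stolz \<tau> 2"
  have \<phi>_inf: "filterlim \<phi> at_infinity ?F"
    using conf filterlim_mono[OF _ order_refl stolz_filter_le]
    by (auto simp: conformal_onto_halfplane_def)
  have maps: "\<phi> \<in> unit_disc \<rightarrow> upper_halfplane"
    using conf by (auto simp: conformal_onto_halfplane_def bij_betw_def)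
  have 0: "(0::complex) \<in> unit_disc" by simp
  define p q where "p z = Im (\<phi> z)" and "q z = Im (cayley \<tau> z)" for z
  have pos: "p z > 0" "q z > 0" if "z \<in> unit_disc" for z
    using that maps Im_cayley_pos by (auto simp: p_def q_def upper_halfplane_def)
  define R S where "R z = (cmod ((\<phi> z - \<phi> w) / (\<phi> z - \<phi> 0)))\<^sup>2"
    and "S z = (cmod ((cayley \<tau> z - cayley \<tau> w) / (cayley \<tau> z - cayley \<tau> 0)))\<^sup>2" for z
  have "((\<lambda>z. R z * (q w / q 0)) \<longlongrightarrow> (cmod 1)\<^sup>2 * (q w / q 0)) ?F"
    unfolding R_def by (intro tendsto_intros tendsto_ratio_translates \<phi>_inf)
  moreover have "((\<lambda>z. S z * (p w / p 0)) \<longlongrightarrow> (cmod 1)\<^sup>2 * (p w / p 0)) ?F"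
    unfolding S_def by (intro tendsto_intros tendsto_ratio_translates filterlim_cayley_stolz)
  moreover have "\<forall>\<^sub>F z in ?F. R z * (q w / q 0) = S z * (p w / p 0)"
    using eventually_in_stolz filterlim_at_infinity_imp_eventually_ne[OF \<phi>_inf, of "\<phi> 0"]
      filterlim_at_infinity_imp_eventually_ne[OF filterlim_cayley_stolz, of "cayley \<tau> 0"]
  proof eventually_elim
    case (elim z)
    then have z: "z \<in> unit_disc" by (simp add: stolz_def)
    define X X0 Y Y0 where "X = (cmod (\<phi> z - \<phi> w))\<^sup>2" and "X0 = (cmod (\<phi> z - \<phi> 0))\<^sup>2"
      and "Y = (cmod (cayley \<tau> z - cayley \<tau> w))\<^sup>2" and "Y0 = (cmod (cayley \<tau> z - cayley \<tau> 0))\<^sup>2"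
    have nz: "X0 > 0" "Y0 > 0" using elim by (auto simp: X0_def Y0_def)
    have "X * (q z * q w) = Y * (p z * p w)" "X0 * (q z * q 0) = Y0 * (p z * p 0)"
      using conformal_isometry[OF conf z w] conformal_isometry[OF conf z 0]
      by (auto simp: X_def X0_def Y_def Y0_def p_def q_def)
    then have "(X * (q z * q w)) * (Y0 * (p z * p 0)) = (Y * (p z * p w)) * (X0 * (q z * q 0))"
      by simp
    then have "(p z * q z) * (X * q w * (Y0 * p 0)) = (p z * q z) * (Y * p w * (X0 * q 0))"
      by (simp add: mult_ac)
    then have "X * q w * (Y0 * p 0) = Y * p w * (X0 * q 0)" using pos[OF z] by simp
    then have "X / X0 * (q w / q 0) = Y / Y0 * (p w / p 0)"
      using nz pos[OF 0] by (simp add: divide_simps mult_ac)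
    then show ?case by (simp add: R_def S_def X_def X0_def Y_def Y0_def norm_divide power_divide)
  qed
  ultimately have "(cmod 1)\<^sup>2 * (q w / q 0) = (cmod 1)\<^sup>2 * (p w / p 0)"
    using tendsto_unique[OF stolz_filter_nontrivial[of 2]] by (simp add: filterlim_cong)
  then show ?thesis using pos[OF w] pos[OF 0] by (simp add: p_def q_def field_simps)
qed

text \<open>All conformal maps onto the half-plane with pole at \<open>\<tau>\<close> are asymptotically positive multiples of
  each other, because a positive constant ratio of heights is a positive lower bound for the
  angular derivative.\<close>

lemma conformal_ratio_limit:
  assumes conf: "conformal_onto_halfplane \<tau> \<phi>"
  obtains k where "k > 0" "angular_lim (\<lambda>z. \<phi> z / cayley \<tau> z) (nhds (of_real k)) \<tau>"
proof -
  have maps: "\<phi> \<in> unit_disc \<rightarrow> upper_halfplane" and hol: "\<phi> holomorphic_on unit_disc"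
    using conf by (auto simp: conformal_onto_halfplane_def bij_betw_def)
  obtain c where c: "\<And>b. (\<And>z. z \<in> unit_disc \<Longrightarrow> b * Im (cayley \<tau> z) \<le> Im (\<phi> z)) \<Longrightarrow> b \<le> c"
    "angular_lim (\<lambda>z. \<phi> z / cayley \<tau> z) (nhds (of_real c)) \<tau>"
    using julia_caratheodory[OF hol maps] by metis
  define b where "b = Im (\<phi> 0) / Im (cayley \<tau> 0)"
  have "\<phi> 0 \<in> upper_halfplane" using maps by (rule funcset_mem) simp
  then have "b > 0" using Im_cayley_pos[of 0] by (simp add: b_def upper_halfplane_def)
  moreover have "b * Im (cayley \<tau> z) \<le> Im (\<phi> z)" if "z \<in> unit_disc" for z
    using conformal_Im_proportional[OF conf that] Im_cayley_pos[OF that] by (simp add: b_def[symmetric] field_simps)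
  then have "b \<le> c" by (rule c(1))
  ultimately show thesis using that[of c] c(2) by linarith
qed

lemma angular_lim_unique:
  assumes "angular_lim f (nhds a) \<tau>" "angular_lim f (nhds b) \<tau>"
  shows "a = b"
proof (rule tendsto_unique)
  show "at \<tau> within stolz \<tau> 2 \<noteq> bot" by (rule stolz_filter_nontrivial) simp
  show "(f \<longlongrightarrow> a) (at \<tau> within stolz \<tau> 2)" "(f \<longlongrightarrow> b) (at \<tau> within stolz \<tau> 2)"
    using assms by (auto simp: angular_lim_def)
qed

text \<open>It therefore suffices to test conformality against the coordinate \<open>cayley \<tau>\<close>.\<close>

lemma conformal_relative_to_iff:
  assumes conf: "conformal_onto_halfplane \<tau> \<phi>"
    and lim: "angular_lim (\<lambda>z. h z / cayley \<tau> z) (nhds c) \<tau>"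
  shows "conformal_relative_to h \<tau> \<phi> \<longleftrightarrow> c \<noteq> 0"
proof -
  obtain k where k: "k > 0" "angular_lim (\<lambda>z. \<phi> z / cayley \<tau> z) (nhds (of_real k)) \<tau>"
    using conformal_ratio_limit[OF conf] .
  have "angular_lim (\<lambda>z. h z / \<phi> z) (nhds (c / of_real k)) \<tau>"
    unfolding angular_lim_def
  proof (intro allI impI)
    fix M :: real assume M: "1 < M"
    have "((\<lambda>z. (h z / cayley \<tau> z) / (\<phi> z / cayley \<tau> z)) \<longlongrightarrow> c / of_real k) (at \<tau> within stolz \<tau> M)"
      using lim k M by (intro tendsto_divide) (auto simp: angular_lim_def)
    moreover have "\<forall>\<^sub>F z in at \<tau> within stolz \<tau> M.
        (h z / cayley \<tau> z) / (\<phi> z / cayley \<tau> z) = h z / \<phi> z"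
      using filterlim_at_infinity_imp_eventually_ne[OF filterlim_cayley_stolz, of 0]
      by (rule eventually_mono) simp
    ultimately show "((\<lambda>z. h z / \<phi> z) \<longlongrightarrow> c / of_real k) (at \<tau> within stolz \<tau> M)"
      by (rule Lim_transform_eventually)
  qed
  then show ?thesis
    using k(1) angular_lim_unique unfolding conformal_relative_to_def
    by (metis divide_eq_0_iff of_real_eq_0_iff less_irrefl)
qed

end

section \<open>Hyperbolic distance to a fixed point\<close>

text \<open>Writing \<open>(1 + t) / (1 - t) = (1 + t)\<^sup>2 / (1 - t\<^sup>2)\<close> for the pseudo-hyperbolic distance \<open>t\<close>, only the
  factor \<open>1 - |z|\<^sup>2\<close> of \<open>1 - t\<^sup>2\<close> can degenerate when \<open>w\<close> is fixed.\<close>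

lemma hyp_dist_asymptotic:
  assumes w: "w \<in> unit_disc"
  obtains B where "\<And>z. z \<in> unit_disc \<Longrightarrow> \<bar>hyp_dist z w + ln (1 - (cmod z)\<^sup>2)\<bar> \<le> B"
proof
  fix z assume z: "z \<in> unit_disc"
  define N P Q where "N = cmod (1 - cnj w * z)" and "P = 1 - (cmod z)\<^sup>2" and "Q = 1 - (cmod w)\<^sup>2"
  have P: "P > 0" and Q: "Q > 0" using z w one_minus_cmod_sq_pos by (auto simp: P_def Q_def)
  have N: "1 - cmod w \<le> N" "N \<le> 2" using one_minus_cnj_mult_bounds[OF z w] by (auto simp: N_def)
  have w1: "0 < 1 - cmod w" "1 - cmod w \<le> 1" using w by auto
  have N0: "N > 0" using N w1 by linarith
  define t where "t = cmod ((z - w) / (1 - cnj w * z))"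
  have t0: "t \<ge> 0" by (simp add: t_def)
  have Nsq: "N\<^sup>2 = (cmod (z - w))\<^sup>2 + P * Q" by (simp add: N_def P_def Q_def cmod_one_minus_cnj_mult)
  have "t\<^sup>2 = (cmod (z - w))\<^sup>2 / N\<^sup>2" by (simp add: t_def N_def norm_divide power_divide)
  then have t2: "1 - t\<^sup>2 = P * Q / N\<^sup>2" using N0 by (simp add: field_simps, simp add: Nsq algebra_simps)
  moreover have "0 < P * Q / N\<^sup>2" using P Q N0 by simp
  ultimately have "t\<^sup>2 < 1" by linarith
  then have t1: "t < 1" using t0 by (simp add: power_less_one_iff abs_square_less_1)
  have "(1 + t) / (1 - t) = (1 + t)\<^sup>2 / (1 - t\<^sup>2)"
    using t0 t1 \<open>t\<^sup>2 < 1\<close> by (simp add: divide_simps) (simp add: power2_eq_square algebra_simps)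
  also have "\<dots> = (1 + t)\<^sup>2 * N\<^sup>2 / (P * Q)" by (simp add: t2)
  finally have "hyp_dist z w = ln ((1 + t)\<^sup>2 * N\<^sup>2 / (P * Q))"
    by (simp add: hyp_dist_def artanh_def t_def)
  also have "\<dots> = 2 * ln (1 + t) + 2 * ln N - ln P - ln Q"
    using t0 N0 P Q by (simp add: ln_div ln_mult ln_realpow)
  finally have "hyp_dist z w + ln P = 2 * ln (1 + t) + 2 * ln N - ln Q" by simp
  moreover have "0 \<le> ln (1 + t)" "ln (1 + t) \<le> ln 2" using t0 t1 by auto
  moreover have "ln (1 - cmod w) \<le> ln N" "ln N \<le> ln 2" "ln (1 - cmod w) \<le> 0"
    using N N0 w1 by auto
  ultimately show "\<bar>hyp_dist z w + ln (1 - (cmod z)\<^sup>2)\<bar>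
      \<le> 4 * ln 2 - 2 * ln (1 - cmod w) + \<bar>ln (1 - (cmod w)\<^sup>2)\<bar>"
    unfolding P_def Q_def by linarith
qed

section \<open>Orbits of a hyperbolic map\<close>

locale hyperbolic_map = boundary_point +
  fixes g :: "complex \<Rightarrow> complex" and \<alpha> :: real
  assumes hol_g: "g holomorphic_on unit_disc" and self_g: "g \<in> unit_disc \<rightarrow> unit_disc"
    and iterates_lim: "z \<in> unit_disc \<Longrightarrow> (\<lambda>n. (g ^^ n) z) \<longlonglongrightarrow> \<tau>"
    and multiplier: "angular_multiplier g \<tau> \<alpha>"
    and \<alpha>_pos: "0 < \<alpha>" and \<alpha>_less_1: "\<alpha> < 1"
begin

lemma iterate_in_disc: "z \<in> unit_disc \<Longrightarrow> (g ^^ n) z \<in> unit_disc"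
  using self_g by (induction n) auto

text \<open>An orbit whose moduli tend to one cannot lose modulus at all late steps, so infinitely many steps do
  not move away from the circle. Along these Julia's inequality applies with \<open>\<beta> = 1\<close>.\<close>

lemma wolff_horocycle:
  assumes z: "z \<in> unit_disc"
  shows "(1 - (cmod z)\<^sup>2) * (cmod (\<tau> - g z))\<^sup>2 \<le> (1 - (cmod (g z))\<^sup>2) * (cmod (\<tau> - z))\<^sup>2"
proof -
  define x where "x n = (g ^^ n) 0" for n
  have x_disc: "x n \<in> unit_disc" for n unfolding x_def by (rule iterate_in_disc) simp
  have x_lim: "x \<longlonglongrightarrow> \<tau>" unfolding x_def[abs_def] by (rule iterates_lim) simp
  have x_Suc: "g (x n) = x (Suc n)" for n by (simp add: x_def)
  have "\<exists>k\<ge>n. cmod (x k) \<le> cmod (x (Suc k))" for n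
  proof (rule ccontr)
    assume "\<not> ?thesis"
    then have dec: "cmod (x (Suc k)) < cmod (x k)" if "k \<ge> n" for k using that by force
    have "cmod (x k) \<le> cmod (x n)" if "k \<ge> n" for k
      using that by (induction rule: dec_induct) (use dec in \<open>force+\<close>)
    then have "cmod \<tau> \<le> cmod (x n)"
      using tendsto_norm[OF x_lim] by (intro LIMSEQ_le_const2) auto
    then show False using x_disc[of n] norm_\<tau> by simp
  qed
  then obtain k where k: "k n \<ge> n" "cmod (x (k n)) \<le> cmod (x (Suc (k n)))" for n by metis
  have k_top: "filterlim k at_top sequentially"
    by (rule filterlim_at_top_mono[OF filterlim_ident]) (use k in auto)
  have "(1 - (cmod z)\<^sup>2) * (cmod (\<tau> - g z))\<^sup>2 \<le> 1 * (1 - (cmod (g z))\<^sup>2) * (cmod (\<tau> - z))\<^sup>2"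
  proof (rule julia_horocycle[OF hol_g self_g norm_\<tau> _ _ _ _ z])
    show "x (k n) \<in> unit_disc" for n by (rule x_disc)
    show "(\<lambda>n. x (k n)) \<longlonglongrightarrow> \<tau>" by (rule filterlim_compose[OF x_lim k_top])
    show "(\<lambda>n. g (x (k n))) \<longlonglongrightarrow> \<tau>"
      unfolding x_Suc
      by (rule filterlim_compose[OF x_lim filterlim_compose[OF filterlim_Suc k_top]])
    show "\<forall>\<^sub>F n in sequentially. 1 - cmod (g (x (k n))) \<le> 1 * (1 - cmod (x (k n)))"
      unfolding x_Suc using k by simp
  qed
  then show ?thesis by simp
qed

text \<open>The horocycle through a radial point shrinks to \<open>\<tau>\<close>, and Wolff's theorem keeps the image point
  inside it. This provides the boundary value that turns information on \<open>g'\<close> into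
  information on \<open>g\<close> itself.\<close>

lemma radial_image_lim: "(\<lambda>n. g (radial n)) \<longlonglongrightarrow> \<tau>"
proof -
  have bound: "(cmod (g (radial n) - \<tau>))\<^sup>2 \<le> cmod (radial n - \<tau>)" for n
  proof -
    define r where "r = cmod (radial n)"
    have r: "0 \<le> r" "r < 1" using radial_in_disc[of n] by (auto simp: r_def)
    have nn: "0 \<le> (cmod (\<tau> - g (radial n)))\<^sup>2" by simp
    have "(1 - r\<^sup>2) * (cmod (\<tau> - g (radial n)))\<^sup>2 \<le> (1 - (cmod (g (radial n)))\<^sup>2) * (1 - r)\<^sup>2"
      using wolff_horocycle[OF radial_in_disc[of n]] cmod_radial_diff[of n]
      by (simp add: r_def norm_minus_commute)
    also have "\<dots> \<le> 1 * (1 - r)\<^sup>2" by (intro mult_right_mono) auto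
    finally have "(1 - r) * ((1 + r) * (cmod (\<tau> - g (radial n)))\<^sup>2) \<le> (1 - r) * (1 - r)"
      by (simp add: power2_eq_square algebra_simps)
    then have "(1 + r) * (cmod (\<tau> - g (radial n)))\<^sup>2 \<le> 1 - r"
      using r by (simp add: mult_le_cancel_left_pos)
    moreover have "0 \<le> r * (cmod (\<tau> - g (radial n)))\<^sup>2" using r by simp
    ultimately have "(cmod (\<tau> - g (radial n)))\<^sup>2 \<le> 1 - r" by (simp add: algebra_simps)
    then show ?thesis using cmod_radial_diff[of n] by (simp add: r_def norm_minus_commute)
  qed
  have "(\<lambda>n. cmod (radial n - \<tau>)) \<longlonglongrightarrow> 0"
    using radial_lim by (simp add: tendsto_norm_zero_iff LIM_zero_iff)
  then have "(\<lambda>n. (cmod (g (radial n) - \<tau>))\<^sup>2) \<longlonglongrightarrow> 0"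
    by (rule tendsto_sandwich[OF _ _ tendsto_const, rotated 2]) (use bound in auto)
  then show ?thesis
    by (simp add: tendsto_norm_zero_iff LIM_zero_iff)
qed

text \<open>Near \<open>\<tau>\<close> the radius satisfies \<open>|g'| \<le> \<beta>\<close>. Integrating up to \<open>\<tau>\<close>, where \<open>g\<close> has the radial
  limit \<open>\<tau>\<close>, bounds \<open>|g z - \<tau>|\<close> and with it the boundary distance of \<open>g z\<close>.\<close>

lemma radial_dilation:
  assumes "\<alpha> < \<beta>"
  shows "\<forall>\<^sub>F n in sequentially. 1 - cmod (g (radial n)) \<le> \<beta> * (1 - cmod (radial n))"
proof -
  have "(deriv g \<longlongrightarrow> of_real \<alpha>) (at \<tau> within stolz \<tau> 2)"
    using multiplier by (auto simp: angular_multiplier_def angular_lim_def)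
  then have "((\<lambda>z. cmod (deriv g z)) \<longlongrightarrow> cmod (of_real \<alpha>)) (at \<tau> within stolz \<tau> 2)"
    by (rule tendsto_norm)
  then have "\<forall>\<^sub>F z in at \<tau> within stolz \<tau> 2. cmod (deriv g z) < \<beta>"
    by (rule order_tendstoD) (use assms \<alpha>_pos in auto)
  then obtain d where d: "d > 0" and
    dd: "\<And>z. \<lbrakk>z \<in> stolz \<tau> 2; z \<noteq> \<tau>; dist z \<tau> < d\<rbrakk> \<Longrightarrow> cmod (deriv g z) < \<beta>"
    unfolding eventually_at by metis
  define S where "S = (\<lambda>r. r *\<^sub>R \<tau>) ` {max 0 (1 - d)<..<1}"
  have S: "cmod z < 1 \<and> cmod (deriv g z) \<le> \<beta>" if zS: "z \<in> S" for z
  proof -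
    obtain r where r: "0 < r" "1 - d < r" "r < 1" "z = r *\<^sub>R \<tau>" using zS by (auto simp: S_def)
    have "z - \<tau> = (- (1 - r)) *\<^sub>R \<tau>" by (simp add: r algebra_simps)
    then have "cmod (z - \<tau>) = 1 - r" using r norm_\<tau> by simp
    moreover have "cmod z = r" using r norm_\<tau> by simp
    ultimately have "z \<in> stolz \<tau> 2" "z \<noteq> \<tau>" "dist z \<tau> < d"
      using r by (auto simp: stolz_def dist_norm)
    then show ?thesis using dd[of z] by (simp add: stolz_def less_imp_le)
  qed
  have "convex S" unfolding S_def
    by (intro convex_linear_image convex_real_interval) (auto intro: linear_compose_scale_right linearI simp: algebra_simps)
  moreover have "(g has_field_derivative deriv g z) (at z within S)" if "z \<in> S" for z
    using S[OF that] holomorphic_derivI[OF hol_g open_ball] by simp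
  ultimately have lip: "cmod (g x - g y) \<le> \<beta> * cmod (x - y)" if "x \<in> S" "y \<in> S" for x y
    using that S by (intro field_differentiable_bound) auto
  have "(\<lambda>n. 1 - cmod (radial n)) \<longlonglongrightarrow> 1 - cmod \<tau>" by (intro tendsto_intros radial_lim)
  then have "\<forall>\<^sub>F n in sequentially. 1 - cmod (radial n) < d"
    by (rule order_tendstoD) (use d norm_\<tau> in auto)
  then have in_S: "\<forall>\<^sub>F n in sequentially. radial n \<in> S"
  proof eventually_elim
    case (elim n)
    then show ?case
      unfolding S_def cmod_radial unfolding radial_eq by (intro imageI) auto
  qed
  then show ?thesis
  proof eventually_elim
    case (elim n)
    have ev: "\<forall>\<^sub>F m in sequentially. cmod (g (radial n) - g (radial m)) \<le> \<beta> * cmod (radial n - radial m)"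
      using in_S by (rule eventually_mono) (use lip elim in auto)
    have "cmod (g (radial n) - \<tau>) \<le> \<beta> * cmod (radial n - \<tau>)"
      by (rule tendsto_le[OF _ _ _ ev]) (auto intro!: tendsto_intros radial_lim radial_image_lim)
    moreover have "1 - cmod (g (radial n)) \<le> cmod (g (radial n) - \<tau>)"
      using norm_triangle_ineq3[of "g (radial n)" \<tau>] norm_\<tau> by simp
    ultimately show ?case by (simp add: cmod_radial_diff)
  qed
qed

text \<open>The radius to \<open>\<tau>\<close> supplies Julia's inequality for every \<open>\<beta> > \<alpha>\<close>, hence for \<open>\<alpha>\<close> itself.\<close>

lemma Im_cayley_step:
  assumes z: "z \<in> unit_disc"
  shows "Im (cayley \<tau> z) \<le> \<alpha> * Im (cayley \<tau> (g z))"
proof -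
  have gz: "g z \<in> unit_disc" using z self_g by auto
  define X Y where "X = Im (cayley \<tau> z)" and "Y = Im (cayley \<tau> (g z))"
  have Y: "Y > 0" unfolding Y_def by (rule Im_cayley_pos[OF gz])
  have "X / Y \<le> \<beta>" if "\<alpha> < \<beta>" for \<beta>
  proof -
    define a b where "a = (cmod (\<tau> - z))\<^sup>2" and "b = (cmod (\<tau> - g z))\<^sup>2"
    have ab: "a > 0" "b > 0" using \<tau>_neq z gz by (auto simp: a_def b_def)
    have "(1 - (cmod z)\<^sup>2) * b \<le> \<beta> * (1 - (cmod (g z))\<^sup>2) * a"
      unfolding a_def b_def
      by (rule julia_horocycle[OF hol_g self_g norm_\<tau> radial_in_disc radial_lim
            radial_image_lim radial_dilation[OF that] z])
    then have "X \<le> \<beta> * Y"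
      using ab by (simp add: X_def Y_def Im_cayley[OF z] Im_cayley[OF gz] divide_simps mult_ac flip: a_def b_def)
    then show ?thesis using Y by (simp add: divide_simps)
  qed
  then have "X / Y \<le> \<alpha>" by (rule dense_ge)
  then show ?thesis using Y by (simp add: X_def Y_def divide_simps)
qed

lemma Im_cayley_iterate:
  assumes z: "z \<in> unit_disc"
  shows "Im (cayley \<tau> z) \<le> \<alpha> ^ n * Im (cayley \<tau> ((g ^^ n) z))"
proof (induction n)
  case (Suc n)
  have "\<alpha> ^ n * Im (cayley \<tau> ((g ^^ n) z)) \<le> \<alpha> ^ n * (\<alpha> * Im (cayley \<tau> (g ((g ^^ n) z))))"
    using \<alpha>_pos by (intro mult_left_mono Im_cayley_step iterate_in_disc z) auto
  with Suc show ?case by (simp add: mult_ac)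
qed auto

text \<open>The hyperbolic length of the steps of an orbit does not increase, since the step from
  \<open>g\<^sup>n z\<close> is the image under \<open>g\<close> of the preceding one. In the half-plane this bounds the Euclidean
  length of a step by the heights of its two ends.\<close>

lemma iterate_step_bound:
  assumes z: "z \<in> unit_disc"
  obtains K where "K \<ge> 0" "\<And>n. (cmod (cayley \<tau> ((g ^^ Suc n) z) - cayley \<tau> ((g ^^ n) z)))\<^sup>2
      \<le> K * (Im (cayley \<tau> ((g ^^ Suc n) z)) * Im (cayley \<tau> ((g ^^ n) z)))"
proof -
  define u where "u n = cayley \<tau> ((g ^^ n) z)" for n
  have pos: "Im (u n) > 0" for n unfolding u_def by (intro Im_cayley_pos iterate_in_disc z)
  define D where "D n = (cmod (u (Suc n) - u n))\<^sup>2" for n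
  define I where "I n = Im (u (Suc n)) * Im (u n)" for n
  have I: "I n > 0" for n unfolding I_def using pos by simp
  define K where "K = D 0 / I 0"
  have G: "(cayley \<tau> \<circ> g) holomorphic_on unit_disc" "(cayley \<tau> \<circ> g) \<in> unit_disc \<rightarrow> upper_halfplane"
    using self_g cayley_in
    by (auto intro!: holomorphic_on_compose hol_g holomorphic_on_subset[OF holomorphic_cayley])
  have step: "D (Suc n) * I n \<le> D n * I (Suc n)" for n
    using schwarz_pick_halfplane[OF G iterate_in_disc[OF z, of "Suc n"] iterate_in_disc[OF z, of n]]
    by (simp add: D_def I_def u_def)
  have "D n \<le> K * I n" for n
  proof (induction n)
    case 0 then show ?case using I[of 0] by (simp add: K_def)
  next
    case (Suc n)
    have "D (Suc n) * I n \<le> D n * I (Suc n)" by (rule step)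
    also have "\<dots> \<le> (K * I n) * I (Suc n)" using Suc I[of "Suc n"] by (intro mult_right_mono) auto
    finally have "D (Suc n) * I n \<le> (K * I (Suc n)) * I n" by (simp add: mult_ac)
    then show ?case using I[of n] by simp
  qed
  moreover have "K \<ge> 0" unfolding K_def D_def using I[of 0] by simp
  ultimately show thesis using that unfolding D_def I_def u_def by blast
qed

text \<open>Up to bounded errors, \<open>hyp_dist ((g ^^ n) z) w\<close> is minus the logarithm of the boundary distance of
  \<open>(g ^^ n) z\<close>, so the extremal rate says that this boundary distance is comparable with \<open>\<alpha>\<^sup>n\<close>. The
  point \<open>w\<close> has thereby disappeared.\<close>

lemma extremal_rate_at_iff:
  assumes z: "z \<in> unit_disc" and w: "w \<in> unit_disc"
  shows "extremal_rate_at g \<alpha> z w \<longleftrightarrow>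
    (\<exists>a>0. \<exists>b. \<forall>n. a * \<alpha> ^ n \<le> 1 - (cmod ((g ^^ n) z))\<^sup>2 \<and> 1 - (cmod ((g ^^ n) z))\<^sup>2 \<le> b * \<alpha> ^ n)"
proof -
  define e where "e n = 1 - (cmod ((g ^^ n) z))\<^sup>2" for n
  have e: "e n > 0" for n unfolding e_def by (intro one_minus_cmod_sq_pos iterate_in_disc z)
  obtain B where B: "\<And>u. u \<in> unit_disc \<Longrightarrow> \<bar>hyp_dist u w + ln (1 - (cmod u)\<^sup>2)\<bar> \<le> B"
    using hyp_dist_asymptotic[OF w] by blast
  define d where "d n = hyp_dist ((g ^^ n) z) w - real n * ln (1 / \<alpha>)" for n
  define l where "l n = ln (e n / \<alpha> ^ n)" for n
  have l_eq: "l n = ln (e n) + real n * ln (1 / \<alpha>)" for n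
    unfolding l_def using e[of n] \<alpha>_pos by (simp add: ln_div ln_realpow)
  have near: "\<bar>d n + l n\<bar> \<le> B" for n
    using B[OF iterate_in_disc[OF z, of n]] by (simp add: d_def l_eq e_def)
  have between: "exp (- K) * \<alpha> ^ n \<le> e n \<and> e n \<le> exp K * \<alpha> ^ n" if "\<bar>l n\<bar> \<le> K" for K n
  proof -
    have pos: "e n / \<alpha> ^ n > 0" using e \<alpha>_pos by simp
    have "- K \<le> l n" "l n \<le> K" using that by auto
    then have "exp (- K) \<le> exp (l n)" "exp (l n) \<le> exp K" by (simp_all only: exp_le_cancel_iff)
    moreover have "exp (l n) = e n / \<alpha> ^ n" unfolding l_def using pos by (rule exp_ln)
    ultimately have "exp (- K) \<le> e n / \<alpha> ^ n" "e n / \<alpha> ^ n \<le> exp K" by simp_all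
    then show ?thesis using \<alpha>_pos by (simp add: pos_le_divide_eq pos_divide_le_eq)
  qed
  show ?thesis
    unfolding extremal_rate_at_def e_def[symmetric] d_def[symmetric]
  proof
    assume "Bseq d"
    then obtain K where K: "\<And>n. \<bar>d n\<bar> \<le> K" unfolding Bseq_def by auto
    have "\<bar>l n\<bar> \<le> B + K" for n using near[of n] K[of n] by linarith
    then have "\<forall>n. exp (- (B + K)) * \<alpha> ^ n \<le> e n \<and> e n \<le> exp (B + K) * \<alpha> ^ n"
      using between by blast
    then show "\<exists>a>0. \<exists>b. \<forall>n. a * \<alpha> ^ n \<le> e n \<and> e n \<le> b * \<alpha> ^ n"
      by (meson exp_gt_zero)
  next
    assume "\<exists>a>0. \<exists>b. \<forall>n. a * \<alpha> ^ n \<le> e n \<and> e n \<le> b * \<alpha> ^ n"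
    then obtain a b where ab: "a > 0" "\<And>n. a * \<alpha> ^ n \<le> e n" "\<And>n. e n \<le> b * \<alpha> ^ n" by blast
    have "\<bar>d n\<bar> \<le> B + \<bar>ln a\<bar> + \<bar>ln b\<bar>" for n
    proof -
      have pos: "e n / \<alpha> ^ n > 0" using e \<alpha>_pos by simp
      have "a \<le> e n / \<alpha> ^ n" "e n / \<alpha> ^ n \<le> b" using ab \<alpha>_pos by (auto simp: divide_simps)
      then have "ln a \<le> l n" "l n \<le> ln b" unfolding l_def using ab pos by (auto intro!: ln_mono)
      then show ?thesis using near[of n] by linarith
    qed
    then show "Bseq d" by (intro BseqI'[of _ "B + \<bar>ln a\<bar> + \<bar>ln b\<bar>"]) simp
  qed
qed

end

section \<open>The two directions of the equivalence\<close>

locale koenigs_map = hyperbolic_map +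
  fixes h :: "complex \<Rightarrow> complex"
  assumes hol_h: "h holomorphic_on unit_disc" and maps_h: "h \<in> unit_disc \<rightarrow> upper_halfplane"
    and functional: "z \<in> unit_disc \<Longrightarrow> h (g z) = inverse (of_real \<alpha>) * h z"
begin

lemma h_iterate:
  assumes "z \<in> unit_disc"
  shows "of_real (\<alpha> ^ n) * h ((g ^^ n) z) = h z"
proof (induction n)
  case (Suc n)
  have "of_real \<alpha> * h ((g ^^ Suc n) z) = h ((g ^^ n) z)"
    using functional[OF iterate_in_disc[OF assms, of n]] \<alpha>_pos by simp
  then have "of_real (\<alpha> ^ Suc n) * h ((g ^^ Suc n) z) = of_real (\<alpha> ^ n) * h ((g ^^ n) z)"
    by (simp only: power_Suc2 of_real_mult mult.assoc)
  also have "\<dots> = h z" by (rule Suc)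
  finally show ?case .
qed simp

text \<open>At the extremal rate the orbit \<open>u n = cayley \<tau> ((g ^^ n) z)\<close> satisfies \<open>|u n| \<le> const * \<alpha>\<^sup>-\<^sup>n\<close> in the half-plane, while its
  heights are at least \<open>const * \<alpha>\<^sup>-\<^sup>n\<close>. So the orbit stays in one Stolz region and may be used to
  evaluate the angular limit; there \<open>|h|\<close> equals \<open>const * \<alpha>\<^sup>-\<^sup>n\<close> by the functional equation, and the
  ratio cannot tend to zero.\<close>

lemma angular_limit_nonzero_of_extremal:
  assumes z: "z \<in> unit_disc" and w: "w \<in> unit_disc"
    and extremal: "extremal_rate_at g \<alpha> z w"
    and lim: "angular_lim (\<lambda>z. h z / cayley \<tau> z) (nhds L) \<tau>"
  shows "L \<noteq> 0"
proof -
  define x where "x n = (g ^^ n) z" for n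
  define u where "u n = cayley \<tau> (x n)" for n
  have x: "x n \<in> unit_disc" for n unfolding x_def by (rule iterate_in_disc[OF z])
  have u: "Im (u n) > 0" for n unfolding u_def by (rule Im_cayley_pos[OF x])
  obtain a where a: "a > 0" "\<And>n. a * \<alpha> ^ n \<le> 1 - (cmod (x n))\<^sup>2"
    using extremal unfolding extremal_rate_at_iff[OF z w] x_def by blast
  define p where "p = Im (u 0)"
  have p: "p > 0" "\<And>n. p \<le> \<alpha> ^ n * Im (u n)"
    using u[of 0] Im_cayley_iterate[OF z] by (simp_all add: p_def u_def x_def)
  have up: "\<alpha> ^ n * cmod (u n + \<i>) \<le> 4 / a" for n
  proof -
    let ?m = "cmod (u n + \<i>)"
    have m: "Im (u n) + 1 \<le> ?m" by (rule cmod_le_cmod_plus_i(2)[OF u])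
    have m0: "?m > 0" using m u[of n] by linarith
    have "a * \<alpha> ^ n \<le> 4 * Im (u n) / ?m\<^sup>2"
      using a(2)[of n] one_minus_cmod_sq_cayley[OF x, of n] by (simp add: u_def)
    also have "\<dots> \<le> 4 * ?m / ?m\<^sup>2" using m by (intro divide_right_mono) auto
    also have "\<dots> = 4 / ?m" using m0 by (simp add: power2_eq_square)
    finally show ?thesis using a m0 by (simp add: field_simps)
  qed
  define K where "K = 4 / (a * p)"
  have K: "K > 0" using a p by (simp add: K_def)
  have "cmod (u n + \<i>) \<le> K * Im (u n)" for n
  proof -
    have "\<alpha> ^ n * cmod (u n + \<i>) \<le> K * p" using up[of n] p by (simp add: K_def)
    also have "\<dots> \<le> K * (\<alpha> ^ n * Im (u n))" using p K by (intro mult_left_mono) auto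
    finally have "\<alpha> ^ n * cmod (u n + \<i>) \<le> \<alpha> ^ n * (K * Im (u n))" by (simp add: mult_ac)
    then show ?thesis using \<alpha>_pos by (simp add: mult_le_cancel_left_pos)
  qed
  then have stolz: "x n \<in> stolz \<tau> (K + 1)" for n
    using in_stolz_of_cayley[OF x, of n K "K + 1"] by (simp add: u_def)
  have "filterlim x (at \<tau> within stolz \<tau> (K + 1)) sequentially"
    using iterates_lim[OF z] stolz by (intro filterlim_stolz_sequence) (auto simp: x_def[abs_def])
  moreover have "((\<lambda>z. h z / cayley \<tau> z) \<longlongrightarrow> L) (at \<tau> within stolz \<tau> (K + 1))"
    using lim K by (auto simp: angular_lim_def)
  ultimately have "(\<lambda>n. h (x n) / u n) \<longlonglongrightarrow> L"
    unfolding u_def by (rule filterlim_compose[rotated])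
  then have lim_norm: "(\<lambda>n. cmod (h (x n) / u n)) \<longlonglongrightarrow> cmod L" by (rule tendsto_norm)
  have "cmod (h z) * a / 4 \<le> cmod (h (x n) / u n)" for n
  proof -
    have nz: "cmod (u n) > 0" using u[of n] by auto
    have "\<alpha> ^ n * cmod (u n) \<le> \<alpha> ^ n * cmod (u n + \<i>)"
      using cmod_le_cmod_plus_i(1)[OF u, of n] \<alpha>_pos by (intro mult_left_mono) auto
    also have "\<dots> \<le> 4 / a" by (rule up)
    finally have "a / 4 * (\<alpha> ^ n * cmod (u n)) \<le> 1" using a by (simp add: field_simps)
    then have "cmod (h (x n)) * (a / 4 * (\<alpha> ^ n * cmod (u n))) \<le> cmod (h (x n))"
      by (intro mult_left_le) auto
    moreover have "cmod (h z) = \<alpha> ^ n * cmod (h (x n))"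
      using arg_cong[OF h_iterate[OF z, of n], of cmod] \<alpha>_pos by (simp add: x_def norm_mult norm_power)
    ultimately show ?thesis using nz by (simp add: norm_divide field_simps)
  qed
  then have "cmod (h z) * a / 4 \<le> cmod L"
    by (intro LIMSEQ_le_const[OF lim_norm]) auto
  moreover have "cmod (h z) > 0" using funcset_mem[OF maps_h z] by (auto simp: upper_halfplane_def)
  ultimately show ?thesis using a by (auto simp: mult_le_0_iff)
qed

text \<open>If \<open>h\<close> is at least \<open>c\<close> times as high as the coordinate, then the functional equation for \<open>h\<close> bounds
  the heights of the orbit from above by \<open>const * \<alpha>\<^sup>-\<^sup>n\<close>. The Euclidean steps are then bounded by
  the same quantity, and a geometric sum bounds \<open>|u n|\<close> for the orbit \<open>u n\<close> in the half-plane. With the lower bound on the heights this is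
  the extremal rate.\<close>

lemma extremal_of_Im_bound:
  assumes c: "c > 0" and bound: "\<And>z. z \<in> unit_disc \<Longrightarrow> c * Im (cayley \<tau> z) \<le> Im (h z)"
    and z: "z \<in> unit_disc" and w: "w \<in> unit_disc"
  shows "extremal_rate_at g \<alpha> z w"
proof -
  define x where "x n = (g ^^ n) z" for n
  define u where "u n = cayley \<tau> (x n)" for n
  have x: "x n \<in> unit_disc" for n unfolding x_def by (rule iterate_in_disc[OF z])
  have u: "Im (u n) > 0" for n unfolding u_def by (rule Im_cayley_pos[OF x])
  define p where "p = Im (u 0)"
  have p: "p > 0" "\<And>n. p \<le> \<alpha> ^ n * Im (u n)"
    using u[of 0] Im_cayley_iterate[OF z] by (simp_all add: p_def u_def x_def)
  define C where "C = Im (h z) / c"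
  have C: "\<alpha> ^ n * Im (u n) \<le> C" for n
  proof -
    have "Im (h z) = \<alpha> ^ n * Im (h (x n))"
      using arg_cong[OF h_iterate[OF z, of n], of Im] by (simp add: x_def flip: of_real_power)
    moreover have "\<alpha> ^ n * (c * Im (u n)) \<le> \<alpha> ^ n * Im (h (x n))"
      unfolding u_def using \<alpha>_pos by (intro mult_left_mono bound x) auto
    ultimately show ?thesis using c by (simp add: C_def field_simps)
  qed
  have C0: "C > 0" using C[of 0] u[of 0] by simp
  obtain K where K: "K \<ge> 0" "\<And>n. (cmod (u (Suc n) - u n))\<^sup>2 \<le> K * (Im (u (Suc n)) * Im (u n))"
    using iterate_step_bound[OF z] unfolding u_def x_def by blast
  have step: "\<alpha> ^ Suc n * cmod (u (Suc n) - u n) \<le> sqrt K * C" for n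
  proof (rule power2_le_imp_le)
    have "(\<alpha> ^ Suc n * cmod (u (Suc n) - u n))\<^sup>2 = (\<alpha> ^ Suc n)\<^sup>2 * (cmod (u (Suc n) - u n))\<^sup>2"
      by (simp add: power_mult_distrib)
    also have "\<dots> \<le> (\<alpha> ^ Suc n)\<^sup>2 * (K * (Im (u (Suc n)) * Im (u n)))"
      by (intro mult_left_mono K) auto
    also have "\<dots> = \<alpha> * (K * ((\<alpha> ^ Suc n * Im (u (Suc n))) * (\<alpha> ^ n * Im (u n))))"
      by (simp add: power2_eq_square mult_ac)
    also have "\<dots> \<le> 1 * (K * ((\<alpha> ^ Suc n * Im (u (Suc n))) * (\<alpha> ^ n * Im (u n))))"
      using \<alpha>_pos \<alpha>_less_1 K(1) u[of n] u[of "Suc n"]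
      by (intro mult_right_mono) auto
    also have "\<dots> \<le> 1 * (K * (C * C))"
      using \<alpha>_pos K(1) u[of n] u[of "Suc n"] C0 C[of n] C[of "Suc n"]
      by (intro mult_left_mono mult_mono) auto
    also have "\<dots> = (sqrt K * C)\<^sup>2" using K(1) by (simp add: power_mult_distrib power2_eq_square)
    finally show "(\<alpha> ^ Suc n * cmod (u (Suc n) - u n))\<^sup>2 \<le> (sqrt K * C)\<^sup>2" .
  qed (use K(1) C0 in auto)
  \<comment> \<open>Large enough that \<open>y \<mapsto> \<alpha> * y + sqrt K * C\<close>, the recursive bound for \<open>\<alpha>\<^sup>n * |u n|\<close>, maps
      \<open>[0, A]\<close> into itself.\<close>
  define A where "A = cmod (u 0) + sqrt K * C / (1 - \<alpha>)"
  have A_ge: "0 \<le> sqrt K * C / (1 - \<alpha>)" using K(1) C0 \<alpha>_less_1 by simp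
  have A_step: "\<alpha> * A + sqrt K * C \<le> A"
  proof -
    have "A - \<alpha> * A = (1 - \<alpha>) * A" by (simp add: algebra_simps)
    also have "\<dots> = (1 - \<alpha>) * cmod (u 0) + sqrt K * C"
      using \<alpha>_less_1 by (simp add: A_def distrib_left)
    finally have "A - \<alpha> * A = (1 - \<alpha>) * cmod (u 0) + sqrt K * C" .
    moreover have "0 \<le> (1 - \<alpha>) * cmod (u 0)" using \<alpha>_less_1 by simp
    ultimately show ?thesis by linarith
  qed
  have A: "\<alpha> ^ n * cmod (u n) \<le> A" for n
  proof (induction n)
    case 0 then show ?case using A_ge by (simp add: A_def)
  next
    case (Suc n)
    have "cmod (u (Suc n)) \<le> cmod (u n) + cmod (u (Suc n) - u n)"
      using norm_triangle_ineq[of "u n" "u (Suc n) - u n"] by simp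
    then have "\<alpha> ^ Suc n * cmod (u (Suc n)) \<le> \<alpha> ^ Suc n * (cmod (u n) + cmod (u (Suc n) - u n))"
      using \<alpha>_pos by (intro mult_left_mono) auto
    also have "\<dots> = \<alpha> * (\<alpha> ^ n * cmod (u n)) + \<alpha> ^ Suc n * cmod (u (Suc n) - u n)"
      by (simp add: algebra_simps)
    also have "\<dots> \<le> \<alpha> * A + sqrt K * C"
      using Suc step[of n] \<alpha>_pos by (intro add_mono mult_left_mono) auto
    finally show ?case using A_step by linarith
  qed
  have A0: "A \<ge> 0" using A_ge norm_ge_zero[of "u 0"] unfolding A_def by linarith
  define a where "a = 4 * p / (A + 1)\<^sup>2"
  have a: "a > 0" using p A0 by (simp add: a_def)
  have "a * \<alpha> ^ n \<le> 1 - (cmod (x n))\<^sup>2 \<and> 1 - (cmod (x n))\<^sup>2 \<le> (4 / p) * \<alpha> ^ n" for n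
  proof -
    define m where "m = cmod (u n + \<i>)"
    define q where "q = \<alpha> ^ n"
    have q: "q > 0" "q \<le> 1" using \<alpha>_pos \<alpha>_less_1 by (auto simp: q_def power_le_one)
    have m: "Im (u n) + 1 \<le> m" unfolding m_def by (rule cmod_le_cmod_plus_i(2)[OF u])
    have m0: "m > 0" using m u[of n] by linarith
    have e: "1 - (cmod (x n))\<^sup>2 = 4 * Im (u n) / m\<^sup>2"
      unfolding m_def u_def by (rule one_minus_cmod_sq_cayley[OF x])
    have pq: "p \<le> q * Im (u n)" unfolding q_def by (rule p(2))
    have "m \<le> cmod (u n) + 1" unfolding m_def using norm_triangle_ineq[of "u n" \<i>] by simp
    then have "q * m \<le> q * (cmod (u n) + 1)" using q by (intro mult_left_mono) auto
    also have "\<dots> \<le> A + 1" using A[of n] q by (simp add: q_def algebra_simps)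
    finally have "(q * m)\<^sup>2 \<le> (A + 1)\<^sup>2" using q m0 by (intro power_mono) auto
    then have "a * q \<le> 4 * p / (q * m)\<^sup>2 * q"
      unfolding a_def using p q m0 A0 by (intro mult_right_mono divide_left_mono) auto
    also have "\<dots> = 4 * (p / q) / m\<^sup>2" using q by (simp add: power2_eq_square)
    also have "\<dots> \<le> 4 * Im (u n) / m\<^sup>2"
      using pq q by (intro divide_right_mono mult_left_mono) (auto simp: divide_simps mult_ac)
    finally have 1: "a * q \<le> 1 - (cmod (x n))\<^sup>2" by (simp add: e)
    have "4 * Im (u n) / m\<^sup>2 \<le> 4 * Im (u n) / (Im (u n))\<^sup>2"
      using m u[of n] m0 by (intro divide_left_mono power_mono) auto
    also have "\<dots> = 4 / Im (u n)" using u[of n] by (simp add: power2_eq_square)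
    also have "\<dots> \<le> (4 / p) * q" using pq p(1) u[of n] by (simp add: divide_simps mult_ac)
    finally show ?thesis using 1 by (simp add: e q_def)
  qed
  then show ?thesis unfolding extremal_rate_at_iff[OF z w] x_def using a by blast
qed

end

theorem theorem3p16:
  fixes g h :: "complex \<Rightarrow> complex" and \<tau> :: complex and \<alpha> :: real
  assumes "hyperbolic_self_map g \<tau> \<alpha>"
    and "koenigs_function g \<tau> \<alpha> h"
    and "h \<in> unit_disc \<rightarrow> upper_halfplane"
  shows "(extremal_hyperbolic_rate g \<alpha> \<longleftrightarrow> conformal_at_boundary h \<tau>)
    \<and> (extremal_hyperbolic_rate g \<alpha> \<longleftrightarrow>
         (\<forall>z\<in>unit_disc. \<forall>w\<in>unit_disc. extremal_rate_at g \<alpha> z w))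
    \<and> (conformal_at_boundary h \<tau> \<longleftrightarrow>
         (\<forall>\<phi>. conformal_onto_halfplane \<tau> \<phi> \<longrightarrow> conformal_relative_to h \<tau> \<phi>))"
proof -
  interpret koenigs_map \<tau> g \<alpha> h
    using assms unfolding hyperbolic_self_map_def koenigs_function_def denjoy_wolff_point_def
    by unfold_locales (auto simp del: mem_ball)
  obtain c where c: "c \<ge> 0" "\<And>z. z \<in> unit_disc \<Longrightarrow> c * Im (cayley \<tau> z) \<le> Im (h z)"
    "angular_lim (\<lambda>z. h z / cayley \<tau> z) (nhds (of_real c)) \<tau>"
    using julia_caratheodory[OF hol_h maps_h] by metis
  have relative: "conformal_relative_to h \<tau> \<phi> \<longleftrightarrow> c \<noteq> 0" if "conformal_onto_halfplane \<tau> \<phi>" for \<phi>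
    using conformal_relative_to_iff[OF that c(3)] by simp
  have some: "c \<noteq> 0" if "extremal_hyperbolic_rate g \<alpha>"
    using that angular_limit_nonzero_of_extremal[OF _ _ _ c(3)]
    by (auto simp: extremal_hyperbolic_rate_def simp del: mem_ball)
  have all: "\<forall>z\<in>unit_disc. \<forall>w\<in>unit_disc. extremal_rate_at g \<alpha> z w" if "c \<noteq> 0"
    using that c(1) extremal_of_Im_bound[OF _ c(2)] by (auto simp del: mem_ball)
  have "(0::complex) \<in> unit_disc" by simp
  then have "extremal_hyperbolic_rate g \<alpha>"
    if "\<forall>z\<in>unit_disc. \<forall>w\<in>unit_disc. extremal_rate_at g \<alpha> z w"
    using that unfolding extremal_hyperbolic_rate_def by blast
  then show ?thesis
    using some all relative conformal_cayley unfolding conformal_at_boundary_def by blast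
qed

end
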